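(* There is no symmetric association scheme $\mathcal{A} = (X, \{R_0, R_1, R_2, R_3, R_4\})$ with $R_0 = \mathrm{Id}_X$ whose intersection numbers, written as matrices $(p^h_{ij})_{i,j=0}^4$ for $h = 0,\dots,4$ (rows indexed by $i$, columns by $j$), are: $(p^0_{ij}) = \mathrm{diag}(1, 8, 8, 4, 24)$; $(p^1_{ij})$ has rows $(0,1,0,0,0)$, $(1,0,1,0,6)$, $(0,1,3,1,3)$, $(0,0,1,0,3)$, $(0,6,3,3,12)$; $(p^2_{ij})$ has rows $(0,0,1,0,0)$, $(0,1,3,1,3)$, $(1,3,1,0,3)$, $(0,1,0,0,3)$, $(0,3,3,3,15)$; $(p^3_{ij})$ has rows $(0,0,0,1,0)$, $(0,0,2,0,6)$, $(0,2,0,0,6)$, $(1,0,0,3,0)$, $(0,6,6,0,12)$; $(p^4_{ij})$ has rows $(0,0,0,0,1)$, $(0,2,1,1,4)$, $(0,1,1,1,5)$, $(0,1,1,0,2)$, $(1,4,5,2,12)$.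
   Context: A symmetric association scheme is a pair $(X, \{R_i \mid i \in \mathcal{I}\})$ where $X$ is a finite set and the $R_i$ are nonempty symmetric binary relations on $X$ partitioning $X^2$, with $R_0$ the identity relation, such that for all $h,i,j$ there is a number $p^h_{ij}$ (intersection number) with the property that for every $(x,y) \in R_h$ there are exactly $p^h_{ij}$ vertices $z$ with $(x,z) \in R_i$ and $(z,y) \in R_j$. (Such a scheme would have $45$ vertices.) *)

theory Defs
  imports "HOL-Library.Disjoint_Sets"
begin

(* Several n can qualify only if R h is empty, which an association scheme excludes. *)
definition is_intersection_number ::
  "'a set \<Rightarrow> ('i \<Rightarrow> ('a \<times> 'a) set) \<Rightarrow> 'i \<Rightarrow> 'i \<Rightarrow> 'i \<Rightarrow> nat \<Rightarrow> bool" where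
  "is_intersection_number X R h i j n \<longleftrightarrow>
     (\<forall>(x, y) \<in> R h. card {z \<in> X. (x, z) \<in> R i \<and> (z, y) \<in> R j} = n)"

(* The index e is the one of the identity relation. *)
definition symmetric_association_scheme ::
  "'a set \<Rightarrow> 'i set \<Rightarrow> 'i \<Rightarrow> ('i \<Rightarrow> ('a \<times> 'a) set) \<Rightarrow> bool" where
  "symmetric_association_scheme X I e R \<longleftrightarrow>
     finite X \<and>
     (\<forall>i\<in>I. R i \<noteq> {} \<and> sym (R i)) \<and>
     (\<Union>i\<in>I. R i) = X \<times> X \<and> disjoint_family_on R I \<and>
     e \<in> I \<and> R e = Id_on X \<and>
     (\<forall>h\<in>I. \<forall>i\<in>I. \<forall>j\<in>I. \<exists>n. is_intersection_number X R h i j n)"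

(* intersection_matrices ! h ! i ! j is the intersection number with upper index h and lower indices i, j. *)
definition intersection_matrices :: "nat list list list" where
  "intersection_matrices =
    [[[1, 0, 0, 0,  0],
      [0, 8, 0, 0,  0],
      [0, 0, 8, 0,  0],
      [0, 0, 0, 4,  0],
      [0, 0, 0, 0, 24]],

     [[0, 1, 0, 0,  0],
      [1, 0, 1, 0,  6],
      [0, 1, 3, 1,  3],
      [0, 0, 1, 0,  3],
      [0, 6, 3, 3, 12]],

     [[0, 0, 1, 0,  0],
      [0, 1, 3, 1,  3],
      [1, 3, 1, 0,  3],
      [0, 1, 0, 0,  3],
      [0, 3, 3, 3, 15]],

     [[0, 0, 0, 1,  0],
      [0, 0, 2, 0,  6],
      [0, 2, 0, 0,  6],
      [1, 0, 0, 3,  0],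
      [0, 6, 6, 0, 12]],

     [[0, 0, 0, 0,  1],
      [0, 2, 1, 1,  4],
      [0, 1, 1, 1,  5],
      [0, 1, 1, 0,  2],
      [1, 4, 5, 2, 12]]]"

end

theory Submission
  imports Defs "HOL-Analysis.Analysis"
begin

text \<open>
  The relation \<open>R\<^sub>0 \<union> R\<^sub>3\<close> is an equivalence with nine blocks of size five. On the 36-dimensional space
  \<open>V\<close> of rational vectors with vanishing block sums, the adjacency matrix \<open>A\<close> of \<open>R\<^sub>1\<close> satisfies the irreducible
  cubic \<open>\<theta>\<^sup>3 - 12 \<theta> + 14 = 0\<close>, so \<open>V\<close> is a vector space of dimension 12 over the cubic field \<open>\<rat>(\<theta>)\<close>.
  The integral matrix \<open>U = I - 3 A\<^sub>2\<close> acts on \<open>V\<close> as a unit of \<open>\<int>[\<theta>]\<close> that is a quadratic non-residue modulo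
  the ramified prime over 5. The contradiction is a reciprocity argument in the style of Bruck--Ryser: the Gauss
  sum of the quadratic form \<open>x \<bullet> U x\<close> is evaluated in two ways.

  Archimedean side: a \<open>\<rat>(\<theta>)\<close>-line in \<open>V\<close> carries a form of signature \<open>(1, 2)\<close>, so in an orthogonal basis of
  \<open>V\<close> the Gauss sum is a positive multiple of \<open>exp (- \<pi> \<i> / 4) ^ 12 = -1\<close>, by Gauss's evaluation of the
  one-dimensional sums.
  Arithmetic side: \<open>U\<close> is invertible on the lattice of integral vectors in \<open>V\<close>, on which the form is even. Hence the
  Gauss sum is a non-negative multiple of the Gauss sum of the discriminant form, which lives on the nine block
  sums modulo 5, where it is positive.
\<close>

subsection \<open>Quadratic Gauss sums\<close>

text \<open>The Euclidean form itself gives no contradiction: the integral vectors with vanishing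
  block sums form nine copies of the root lattice of type A4, whose signature 36 and discriminant
  form obey the reciprocity law. Twisting by \<open>U\<close> changes one side only. Each vertex has
  exactly one \<open>R_2\<close>-neighbour in every other block, so \<open>U\<close> acts on block
  sums as \<open>4 I - 3 J\<close> with \<open>J\<close> the all-one matrix. Modulo 5 its
  eigenvalues are the residue 4, eight times, and the non-residue -23 = 2, once, on the constant
  vector; hence the discriminant Gauss sum changes sign. The signature changes from 36 to 12 * (1 -
  2) = -12, and both are 4 modulo 8, so the archimedean side keeps its sign.

  The eigenvalues of \<open>A\<close> on \<open>V\<close> are irrational. Splitting \<open>V\<close>
  into lines over the cubic field takes the place of eigenspaces: it yields a rational orthogonal
  basis and determines the number of negative weights. Gauss sums over finite boxes of indices take
  the place of local symbols and their product formula.\<close>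

definition e1 :: "real \<Rightarrow> complex" where
  "e1 x = cis (2 * pi * x)"

lemma e1_add: "e1 (x + y) = e1 x * e1 y"
  by (simp add: e1_def cis_mult algebra_simps)

lemma norm_e1 [simp]: "norm (e1 x) = 1"
  by (simp add: e1_def)

lemma e1_eq_1_iff: "e1 x = 1 \<longleftrightarrow> x \<in> \<int>"
proof
  assume "e1 x = 1"
  then have "cos (2 * pi * x) = 1"
    by (simp add: e1_def complex_eq_iff)
  then obtain n :: int where "2 * pi * x = of_int n * 2 * pi"
    by (auto simp: cos_one_2pi_int)
  then have "x = of_int n" by simp
  then show "x \<in> \<int>" by simp
qed (simp add: e1_def cis_multiple_2pi)

lemma e1_Ints: "x \<in> \<int> \<Longrightarrow> e1 x = 1"
  by (simp add: e1_eq_1_iff)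

lemma e1_0 [simp]: "e1 0 = 1"
  by (simp add: e1_Ints)

lemma e1_cong: "x - y \<in> \<int> \<Longrightarrow> e1 x = e1 y"
  using e1_add[of y "x - y"] by (simp add: e1_Ints)

lemma e1_power: "e1 x ^ n = e1 (of_nat n * x)"
  by (simp add: e1_def Complex.DeMoivre mult.left_commute mult.assoc)

lemma sum_e1_character:
  assumes "of_nat c * x \<in> \<int>"
  shows "(\<Sum>j<c. e1 (of_nat j * x)) = (if x \<in> \<int> then of_nat c else 0)"
proof -
  have "e1 x ^ c = 1"
    using assms by (simp add: e1_power e1_eq_1_iff)
  then show ?thesis
    by (auto simp: e1_power[symmetric] e1_eq_1_iff[symmetric] sum_gp_strict)
qed

text \<open>The denominator \<open>4 a\<close> and the period \<open>2 a\<close> make the argument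
  pi / 4 for every \<open>a\<close>, without the case distinction modulo 4 of the classical
  sum.\<close>

definition gauss_sum :: "nat \<Rightarrow> complex" where
  "gauss_sum a = (\<Sum>t<2 * a. e1 ((of_nat t)\<^sup>2 / (4 * of_nat a)))"

text \<open>For \<open>t = u + j * (2 * a * c)\<close> the dependence on \<open>j\<close> is the
  character \<open>e1 (j * u / c)\<close>. Its sum over \<open>j\<close> kills every
  \<open>u\<close> not divisible by \<open>c\<close>, and the surviving \<open>u = m * c\<close>
  give the sum for \<open>a\<close>.\<close>

lemma gauss_sum_mult_square:
  assumes "a > 0" "c > 0"
  shows "gauss_sum (a * c\<^sup>2) = of_nat c * gauss_sum a"
proof -
  define f where "f t = e1 ((of_nat t)\<^sup>2 / (4 * of_nat (a * c\<^sup>2)))" for t :: nat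
  have fs: "f (u + j * (2 * a * c)) = f u * e1 (of_nat j * (of_nat u / of_nat c))" for u j
  proof -
    have "(of_nat (u + j * (2 * a * c)))\<^sup>2 / (4 * of_nat (a * c\<^sup>2)) =
        (of_nat u)\<^sup>2 / (4 * of_nat (a * c\<^sup>2)) + of_nat j * (of_nat u / of_nat c) + (of_nat (a * j\<^sup>2) :: real)"
      using assms by (simp add: field_simps power2_eq_square)
    then have "f (u + j * (2 * a * c)) =
        e1 ((of_nat u)\<^sup>2 / (4 * of_nat (a * c\<^sup>2)) + of_nat j * (of_nat u / of_nat c) + of_nat (a * j\<^sup>2))"
      unfolding f_def by simp
    also have "\<dots> = f u * e1 (of_nat j * (of_nat u / of_nat c)) * e1 (of_nat (a * j\<^sup>2))"
      unfolding e1_add f_def ..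
    finally show ?thesis by (simp add: e1_Ints)
  qed
  have div: "(of_nat u / of_nat c :: real) \<in> \<int> \<longleftrightarrow> c dvd u" for u
  proof
    assume "(of_nat u / of_nat c :: real) \<in> \<int>"
    then obtain k :: int where "of_nat u / of_nat c = (of_int k :: real)" by (elim Ints_cases)
    then have "(of_int (int u) :: real) = of_int (k * int c)" using assms by (simp add: field_simps)
    then have "int u = k * int c" by (simp only: of_int_eq_iff)
    then show "c dvd u" by (metis dvd_triv_right int_dvd_int_iff)
  qed (use assms in auto)
  have "gauss_sum (a * c\<^sup>2) = (\<Sum>t<c * (2 * a * c). f t)"
    unfolding gauss_sum_def f_def by (rule sum.cong) (auto simp: power2_eq_square)
  also have "\<dots> = (\<Sum>j<c. \<Sum>t\<in>{j * (2 * a * c)..<j * (2 * a * c) + 2 * a * c}. f t)"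
    by (rule sum.nat_group[symmetric])
  also have "\<dots> = (\<Sum>j<c. \<Sum>u<2 * a * c. f (u + j * (2 * a * c)))"
  proof (rule sum.cong[OF refl])
    fix j
    show "(\<Sum>t\<in>{j * (2 * a * c)..<j * (2 * a * c) + 2 * a * c}. f t) =
        (\<Sum>u<2 * a * c. f (u + j * (2 * a * c)))"
      using sum.shift_bounds_nat_ivl[of f 0 "j * (2 * a * c)" "2 * a * c"]
      by (simp add: add.commute atLeast0LessThan)
  qed
  also have "\<dots> = (\<Sum>u<2 * a * c. f u * (\<Sum>j<c. e1 (of_nat j * (of_nat u / of_nat c))))"
    unfolding fs sum_distrib_left by (rule sum.swap)
  also have "\<dots> = (\<Sum>u<2 * a * c. if c dvd u then of_nat c * f u else 0)"
  proof (rule sum.cong[OF refl])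
    fix u
    have "of_nat c * (of_nat u / of_nat c :: real) = of_nat u" using assms by simp
    then have "of_nat c * (of_nat u / of_nat c :: real) \<in> \<int>" by (simp only: Ints_of_nat)
    from sum_e1_character[OF this]
    show "f u * (\<Sum>j<c. e1 (of_nat j * (of_nat u / of_nat c))) = (if c dvd u then of_nat c * f u else 0)"
      by (simp add: div mult.commute del: times_divide_eq_right)
  qed
  also have "\<dots> = (\<Sum>m<2 * a. \<Sum>u\<in>{m * c..<m * c + c}. if c dvd u then of_nat c * f u else 0)"
    by (rule sum.nat_group[symmetric])
  also have "\<dots> = (\<Sum>m<2 * a. of_nat c * f (m * c))"
  proof (rule sum.cong[OF refl])
    fix m
    have "c dvd u \<longleftrightarrow> u = m * c" if u: "u \<in> {m * c..<m * c + c}" for u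
    proof
      assume "c dvd u"
      then obtain k where k: "u = c * k" by blast
      have "m * c \<le> k * c" "k * c < Suc m * c"
        using u k by (auto simp: mult.commute)
      then have "m \<le> k" "k < Suc m"
        using assms by (auto simp del: mult_Suc)
      then show "u = m * c" using k by simp
    qed simp
    then have "(\<Sum>u\<in>{m * c..<m * c + c}. if c dvd u then of_nat c * f u else 0) =
        (\<Sum>u\<in>{m * c..<m * c + c}. if u = m * c then of_nat c * f u else 0)"
      by (intro sum.cong) auto
    then show "(\<Sum>u\<in>{m * c..<m * c + c}. if c dvd u then of_nat c * f u else 0) = of_nat c * f (m * c)"
      using assms by simp
  qed
  also have "\<dots> = of_nat c * gauss_sum a"
    using assms by (simp add: gauss_sum_def f_def sum_distrib_left power_mult_distrib field_simps)
  finally show ?thesis .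
qed

lemma norm_e1_minus_1: "norm (e1 x - 1) = 2 * \<bar>sin (pi * x)\<bar>"
proof -
  have "(norm (e1 x - 1))\<^sup>2 = (2 * \<bar>sin (pi * x)\<bar>)\<^sup>2"
  proof -
    have "(norm (e1 x - 1))\<^sup>2 = (cos (2 * (pi * x)) - 1)\<^sup>2 + (sin (2 * (pi * x)))\<^sup>2"
      by (simp add: e1_def cmod_power2 mult.assoc)
    also have "\<dots> = 2 - 2 * cos (2 * (pi * x))"
      using sin_cos_squared_add[of "2 * (pi * x)"] by (simp add: power2_eq_square algebra_simps)
    also have "\<dots> = 4 * (sin (pi * x))\<^sup>2"
      by (simp add: cos_double_sin)
    finally show ?thesis by (simp add: power_mult_distrib)
  qed
  then show ?thesis by (rule power2_eq_imp_eq) auto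
qed

lemma norm_e1_minus_1_le: "norm (e1 x - 1) \<le> 2 * pi * \<bar>x\<bar>"
  using abs_sin_x_le_abs_x[of "pi * x"] by (simp add: norm_e1_minus_1 abs_mult)

lemma norm_e1_diff_le: "norm (e1 x - e1 y) \<le> 2 * pi * \<bar>x - y\<bar>"
proof -
  have "e1 x - e1 y = e1 y * (e1 (x - y) - 1)"
    by (simp add: algebra_simps flip: e1_add)
  then have "norm (e1 x - e1 y) = norm (e1 (x - y) - 1)" by (simp add: norm_mult)
  then show ?thesis using norm_e1_minus_1_le[of "x - y"] by simp
qed

lemma norm_e1_minus_1_ge:
  assumes "0 \<le> x" "x \<le> 1 / 2"
  shows "4 * x \<le> norm (e1 x - 1)"
proof -
  have "2 * x \<le> sin (pi * x)"
  proof -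
    have "concave_on {0..pi} sin"
      by (rule f''_le0_imp_concave[where f' = cos and f'' = "\<lambda>x. - sin x"])
        (auto intro!: derivative_eq_intros simp: sin_ge_zero)
    then have "convex_on {0..pi} (\<lambda>x. - sin x)" by (simp add: concave_on_def)
    from convex_onD[OF this, of "2 * x" 0 "pi / 2"] show ?thesis
      using assms by (simp add: mult.commute)
  qed
  then show ?thesis by (simp add: norm_e1_minus_1)
qed

text \<open>Summation by parts: consecutive terms \<open>f t\<close> differ by \<open>f t * D t\<close>, and \<open>1 / D t\<close> varies slowly.\<close>

lemma e1_quadratic_tail:
  fixes N m H :: nat
  assumes m: "0 < m" "m < H" and H: "2 * H \<le> N"
  shows "norm (\<Sum>t=m..<H. e1 ((of_nat t)\<^sup>2 / (2 * of_nat N))) \<le> of_nat N / of_nat m"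
proof -
  define f where "f t = e1 ((of_nat t)\<^sup>2 / (2 * of_nat N))" for t :: nat
  define \<alpha> :: "nat \<Rightarrow> real" where "\<alpha> t = (2 * of_nat t + 1) / (2 * of_nat N)" for t
  define D where "D t = e1 (\<alpha> t) - 1" for t
  have N: "N > 0" using assms by simp
  have a0: "0 < \<alpha> t" for t using N by (simp add: \<alpha>_def)
  \<comment> \<open>By \<open>2 * H \<le> N\<close> each phase increment stays within half a turn,
    where \<open>norm (e1 x - 1)\<close> has a linear lower bound.\<close>
  have a1: "\<alpha> t \<le> 1 / 2" if "t < H" for t using N that H by (simp add: \<alpha>_def field_simps)
  have aSuc: "\<alpha> (Suc t) = \<alpha> t + 1 / N" for t using N by (simp add: \<alpha>_def field_simps)
  have nf [simp]: "norm (f t) = 1" for t by (simp add: f_def)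
  have Dge: "4 * \<alpha> t \<le> norm (D t)" if "t < H" for t
    unfolding D_def using a0[of t] a1[OF that] by (intro norm_e1_minus_1_ge) auto
  have Dnz: "D t \<noteq> 0" if "t < H" for t
    using Dge[OF that] a0[of t] by auto
  have fD: "f t + f t / D t = f (Suc t) / D t" if "t < H" for t
  proof -
    have "(of_nat (Suc t))\<^sup>2 / (2 * of_nat N) = (of_nat t)\<^sup>2 / (2 * of_nat N) + \<alpha> t"
      using N by (simp add: \<alpha>_def field_simps power2_eq_square)
    then have "f (Suc t) = f t * e1 (\<alpha> t)" by (simp only: f_def e1_add)
    then have "f (Suc t) - f t = f t * D t" by (simp add: D_def algebra_simps)
    then show ?thesis using Dnz[OF that] by (simp add: field_simps)
  qed
  have Dinv: "norm (1 / D t) \<le> 1 / (4 * \<alpha> t)" if "t < H" for t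
    using Dge[OF that] a0[of t] by (simp add: norm_divide frac_le)
  have step: "norm (1 / D t - 1 / D (Suc t)) \<le> 1 / 2 * (1 / \<alpha> t - 1 / \<alpha> (Suc t))" if "Suc t < H" for t
  proof -
    have t: "t < H" using that by simp
    have "1 / D t - 1 / D (Suc t) = (D (Suc t) - D t) * ((1 / D t) * (1 / D (Suc t)))"
      using Dnz[OF that] Dnz[OF t] by (simp add: field_simps)
    also have "norm \<dots> \<le> (2 * pi * (1 / N)) * (1 / (4 * \<alpha> t) * (1 / (4 * \<alpha> (Suc t))))"
      unfolding norm_mult
    proof (intro mult_mono)
      show "norm (D (Suc t) - D t) \<le> 2 * pi * (1 / N)"
        using norm_e1_diff_le[of "\<alpha> (Suc t)" "\<alpha> t"] by (simp add: D_def aSuc)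
    qed (use Dinv[OF t] Dinv[OF that] a0[of t] a0[of "Suc t"] in auto)
    also have "\<dots> = (pi / 8) * (1 / \<alpha> t - 1 / \<alpha> (Suc t))"
    proof -
      have "1 / \<alpha> t - 1 / \<alpha> (Suc t) = (\<alpha> (Suc t) - \<alpha> t) / (\<alpha> t * \<alpha> (Suc t))"
        using a0[of t] a0[of "Suc t"] by (simp add: field_simps)
      then show ?thesis by (simp add: aSuc)
    qed
    also have "\<dots> \<le> (1 / 2) * (1 / \<alpha> t - 1 / \<alpha> (Suc t))"
      using pi_less_4 a0[of t] a0[of "Suc t"] aSuc[of t] by (intro mult_right_mono) (auto simp: frac_le)
    finally show ?thesis .
  qed
  \<comment> \<open>With the boundary term \<open>f (Suc k) / D k\<close> kept inside the norm, each
    step adds only a difference of reciprocals of \<open>D\<close>, and the bounds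
    telescope.\<close>
  have ind: "norm ((\<Sum>t=m..<Suc k. f t) - f (Suc k) / D k) \<le> 1 / (4 * \<alpha> m) + 1 / 2 * (1 / \<alpha> m - 1 / \<alpha> k)"
    if "m \<le> k" "k < H" for k
    using that
  proof (induction k rule: dec_induct)
    case base
    have "(\<Sum>t=m..<Suc m. f t) - f (Suc m) / D m = - f m * (1 / D m)"
      by (simp flip: fD[OF base])
    then have "norm ((\<Sum>t=m..<Suc m. f t) - f (Suc m) / D m) = norm (1 / D m)"
      by (simp only: norm_mult norm_minus_cancel nf mult_1)
    then show ?case using Dinv[OF base] by simp
  next
    case (step k)
    let ?S = "\<Sum>t=m..<Suc k. f t"
    have "(\<Sum>t=m..<Suc (Suc k). f t) - f (Suc (Suc k)) / D (Suc k) =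
        (?S - f (Suc k) / D k) + f (Suc k) * (1 / D k - 1 / D (Suc k))"
      using step.hyps by (simp add: right_diff_distrib flip: fD[OF step.prems])
    also have "norm \<dots> \<le> norm (?S - f (Suc k) / D k) + norm (1 / D k - 1 / D (Suc k))"
      by (rule norm_triangle_le) (simp add: norm_mult)
    also have "\<dots> \<le> 1 / (4 * \<alpha> m) + 1 / 2 * (1 / \<alpha> m - 1 / \<alpha> k) + 1 / 2 * (1 / \<alpha> k - 1 / \<alpha> (Suc k))"
      using step.IH step.prems \<open>Suc k < H \<Longrightarrow> norm (1 / D k - 1 / D (Suc k)) \<le> _\<close> by (intro add_mono) auto
    finally show ?case by (simp add: algebra_simps)
  qed
  obtain k where k: "H = Suc k" using m by (cases H) auto
  have mk: "m \<le> k" "k < H" using m k by auto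
  have "norm (\<Sum>t=m..<Suc k. f t) \<le> norm ((\<Sum>t=m..<Suc k. f t) - f (Suc k) / D k) + norm (f (Suc k) / D k)"
    using norm_triangle_ineq[of "(\<Sum>t=m..<Suc k. f t) - f (Suc k) / D k" "f (Suc k) / D k"] by simp
  also have "\<dots> \<le> 1 / (4 * \<alpha> m) + 1 / 2 * (1 / \<alpha> m - 1 / \<alpha> k) + 1 / (4 * \<alpha> k)"
    using ind[OF mk] Dinv[OF mk(2)] by (intro add_mono) (auto simp: norm_divide)
  also have "\<dots> \<le> 1 / \<alpha> m"
    using a0[of m] a0[of k] by (simp add: field_simps)
  also have "\<dots> \<le> N / m"
    using N m by (simp add: \<alpha>_def field_simps)
  finally show ?thesis by (simp add: k f_def)
qed

lemma riemann_sum_lipschitz: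
  fixes f :: "real \<Rightarrow> complex"
  assumes h: "h \<ge> 0" "L \<ge> 0" and L: "\<And>x y. 0 \<le> x \<Longrightarrow> x \<le> y \<Longrightarrow> y \<le> of_nat m * h \<Longrightarrow> norm (f y - f x) \<le> L * (y - x)"
    and cont: "continuous_on UNIV f"
  shows "norm (of_real h * (\<Sum>t<m. f (of_nat t * h)) - integral {0..of_nat m * h} f) \<le> of_nat m * h\<^sup>2 * L"
  using L
proof (induction m)
  case (Suc m)
  let ?a = "of_nat m * h" and ?b = "of_nat (Suc m) * h"
  have int: "f integrable_on {x..y}" for x y
    using cont by (intro integrable_continuous_interval continuous_on_subset[OF cont]) auto
  have ab: "0 \<le> ?a" "?a \<le> ?b" "?b - ?a = h" using h by (auto simp: algebra_simps)
  have "integral {0..?b} f = integral {0..?a} f + integral {?a..?b} f"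
    using ab int by (intro Henstock_Kurzweil_Integration.integral_combine[symmetric]) auto
  moreover have "norm (of_real h * f ?a - integral {?a..?b} f) \<le> h\<^sup>2 * L"
  proof -
    have "integral {?a..?b} (\<lambda>x. f ?a - f x) = of_real h * f ?a - integral {?a..?b} f"
      using ab int by (subst Henstock_Kurzweil_Integration.integral_diff) (auto simp: scaleR_conv_of_real)
    moreover have "norm (integral {?a..?b} (\<lambda>x. f ?a - f x)) \<le> (h * L) * (?b - ?a)"
    proof (rule integral_bound[OF ab(2)])
      show "continuous_on {?a..?b} (\<lambda>x. f ?a - f x)"
        by (intro continuous_intros continuous_on_subset[OF cont]) auto
      fix x assume x: "x \<in> {?a..?b}"
      show "norm (f ?a - f x) \<le> h * L"
        using Suc.prems[of ?a x] x ab h mult_left_mono[of "x - ?a" h L] by (auto simp: norm_minus_commute mult.commute)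
    qed
    ultimately show ?thesis using ab by (simp add: power2_eq_square mult_ac)
  qed
  moreover have "norm (of_real h * (\<Sum>t<m. f (of_nat t * h)) - integral {0..?a} f) \<le> of_nat m * h\<^sup>2 * L"
    using h by (intro Suc.IH Suc.prems) (auto simp: algebra_simps)
  ultimately show ?case
    using norm_triangle_ineq[of "of_real h * (\<Sum>t<m. f (of_nat t * h)) - integral {0..?a} f" "of_real h * f ?a - integral {?a..?b} f"]
    by (simp add: algebra_simps)
qed auto


text \<open>The reflection \<open>t -> 2 a - t\<close> preserves the summand. Half the range suits
  the tail estimate, where phase increments must not pass half a turn. Doubling counts
  \<open>t = 0\<close> twice and misses \<open>t = a\<close>, whence the correction.\<close>

lemma gauss_sum_half:
  assumes "a > 0"
  shows "gauss_sum a = 2 * (\<Sum>t<a. e1 ((of_nat t)\<^sup>2 / (4 * of_nat a))) + e1 (of_nat a / 4) - 1"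
proof -
  define f where "f t = e1 ((of_nat t)\<^sup>2 / (4 * of_nat a))" for t :: nat
  have refl: "f (2 * a - s) = f s" if "s \<le> 2 * a" for s
    unfolding f_def
  proof (rule e1_cong)
    have "(of_nat (2 * a - s))\<^sup>2 / (4 * of_nat a) - (of_nat s)\<^sup>2 / (4 * of_nat a) = real_of_int (int a - int s)"
      using assms that by (simp add: of_nat_diff power2_eq_square field_simps)
    then show "(of_nat (2 * a - s))\<^sup>2 / (4 * of_nat a) - (of_nat s)\<^sup>2 / (4 * of_nat a) \<in> (\<int> :: real set)"
      by (simp only: Ints_of_int)
  qed
  have "gauss_sum a = (\<Sum>t<a. f t) + (\<Sum>t\<in>{a..<2*a}. f t)"
    unfolding gauss_sum_def f_def[symmetric] by (subst sum.union_disjoint[symmetric]) (auto intro!: sum.cong)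
  also have "(\<Sum>t\<in>{a..<2*a}. f t) = (\<Sum>s\<in>{0<..a}. f s)"
    by (rule sum.reindex_bij_witness[of _ "\<lambda>s. 2 * a - s" "\<lambda>s. 2 * a - s"]) (auto simp: refl)
  also have "\<dots> = (\<Sum>s\<in>insert 0 {0<..a}. f s) - f 0"
    by simp
  also have "insert 0 {0<..a} = {..a}" by auto
  also have "(\<Sum>s\<le>a. f s) = (\<Sum>s<a. f s) + f a"
    by (simp flip: lessThan_Suc_atMost)
  finally show ?thesis
    using assms by (simp add: f_def power2_eq_square)
qed

text \<open>With step \<open>h = 1 / sqrt (2 * a)\<close>, the terms with \<open>t * h\<close> up to
  about \<open>K\<close> form a Riemann sum, and the others obey the tail estimate uniformly in
  \<open>a\<close>. Only \<open>2 / K\<close> survives as \<open>a\<close> grows.\<close>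

lemma gauss_sum_approx:
  fixes K :: real
  assumes K: "K \<ge> 1" and a: "K * sqrt (2 * of_nat a) + 1 < of_nat a"
  shows "norm (gauss_sum a / sqrt (2 * of_nat a) - 2 * integral {0..K} (\<lambda>x. e1 (x\<^sup>2 / 2)))
    \<le> 2 / K + (4 * pi * (K + 1)\<^sup>2 + 4) / sqrt (2 * of_nat a)"
proof -
  define N where "N = 2 * a"
  define F where "F = (\<lambda>x::real. e1 (x\<^sup>2 / 2))"
  define h where "h = 1 / sqrt (of_nat N)"
  define m where "m = nat \<lceil>K * sqrt (of_nat N)\<rceil>"
  have apos: "a > 0"
  proof (rule ccontr)
    assume "\<not> a > 0"
    then show False using a K by simp
  qed
  have N: "N > 0" using apos by (simp add: N_def)
  have sN: "sqrt (of_nat N) \<ge> 1" using N by simp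
  have h: "h > 0" "h \<le> 1" "h * h = 1 / of_nat N" using N sN by (auto simp: h_def)
  have Ks: "K * sqrt (of_nat N) \<ge> 1" using mult_mono[OF K sN] K by simp
  have m1: "K * sqrt (of_nat N) \<le> of_nat m" "of_nat m \<le> K * sqrt (of_nat N) + 1"
    using Ks unfolding m_def by linarith+
  have m: "0 < m" "m < a"
    using m1 Ks a by (auto simp: N_def)
  have mh: "K \<le> of_nat m * h" "of_nat m * h \<le> K + h"
    using m1 sN by (auto simp: h_def field_simps)
  have cont: "continuous_on UNIV F"
    unfolding F_def e1_def cis_conv_exp by (intro continuous_intros) auto
  have int: "F integrable_on {x..y}" for x y
    using cont by (intro integrable_continuous_interval continuous_on_subset[OF cont]) auto
  have Fh: "e1 ((of_nat t)\<^sup>2 / (4 * of_nat a)) = F (of_nat t * h)" for t :: nat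
    using apos by (simp add: F_def h_def N_def power_mult_distrib power_divide)
  have head: "norm (of_real h * (\<Sum>t<m. F (of_nat t * h)) - integral {0..of_nat m * h} F)
      \<le> of_nat m * h\<^sup>2 * (2 * pi * (K + 1))"
  proof (rule riemann_sum_lipschitz[OF _ _ _ cont])
    fix x y :: real assume xy: "0 \<le> x" "x \<le> y" "y \<le> of_nat m * h"
    have "norm (F y - F x) \<le> 2 * pi * \<bar>y\<^sup>2 / 2 - x\<^sup>2 / 2\<bar>"
      unfolding F_def by (rule norm_e1_diff_le)
    also have "y\<^sup>2 / 2 - x\<^sup>2 / 2 = (y + x) / 2 * (y - x)"
      by (simp add: power2_eq_square algebra_simps)
    also have "2 * pi * \<bar>(y + x) / 2 * (y - x)\<bar> = 2 * pi * ((y + x) / 2) * (y - x)"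
      using xy by (simp add: abs_mult)
    also have "\<dots> \<le> 2 * pi * (K + 1) * (y - x)"
      using xy mh h by (intro mult_right_mono mult_left_mono) auto
    finally show "norm (F y - F x) \<le> 2 * pi * (K + 1) * (y - x)" .
  qed (use h K in auto)
  have "of_nat m * h\<^sup>2 * (2 * pi * (K + 1)) \<le> (K + 1) * h * (2 * pi * (K + 1))"
  proof (rule mult_right_mono)
    show "of_nat m * h\<^sup>2 \<le> (K + 1) * h"
      using mult_right_mono[of "of_nat m * h" "K + 1" h] mh h by (simp add: power2_eq_square mult.assoc)
  qed (use K in auto)
  also have "\<dots> = h * (2 * pi * (K + 1)\<^sup>2)"
    by (simp add: power2_eq_square mult_ac)
  finally have head': "norm (of_real h * (\<Sum>t<m. F (of_nat t * h)) - integral {0..of_nat m * h} F)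
      \<le> h * (2 * pi * (K + 1)\<^sup>2)"
    using head by linarith
  have "integral {0..of_nat m * h} F = integral {0..K} F + integral {K..of_nat m * h} F"
    using mh K int by (intro Henstock_Kurzweil_Integration.integral_combine[symmetric]) auto
  moreover have "norm (integral {K..of_nat m * h} F) \<le> 1 * (of_nat m * h - K)"
    by (rule integral_bound[OF mh(1) continuous_on_subset[OF cont]]) (auto simp: F_def)
  ultimately have mid: "norm (integral {0..of_nat m * h} F - integral {0..K} F) \<le> h"
    using mh by simp
  have "norm (\<Sum>t=m..<a. e1 ((of_nat t)\<^sup>2 / (2 * of_nat N))) \<le> of_nat N / of_nat m"
    by (rule e1_quadratic_tail) (use m in \<open>auto simp: N_def\<close>)
  then have "norm (\<Sum>t=m..<a. F (of_nat t * h)) \<le> of_nat N / of_nat m"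
    by (simp add: N_def flip: Fh)
  then have "norm (of_real h * (\<Sum>t=m..<a. F (of_nat t * h))) \<le> h * (of_nat N / of_nat m)"
    using h by (simp add: norm_mult mult_left_mono del: times_divide_eq_right)
  also have "\<dots> \<le> 1 / K"
  proof -
    have "h * of_nat N * K = K * sqrt (of_nat N)"
      using N by (simp add: h_def real_div_sqrt)
    then show ?thesis using m1 m K by (simp add: field_simps)
  qed
  finally have tail: "norm (of_real h * (\<Sum>t=m..<a. F (of_nat t * h))) \<le> 1 / K" .
  have split: "(\<Sum>t<a. F (of_nat t * h)) = (\<Sum>t<m. F (of_nat t * h)) + (\<Sum>t=m..<a. F (of_nat t * h))"
    using m by (subst sum.union_disjoint[symmetric]) (auto intro!: sum.cong)
  define S1 where "S1 = (\<Sum>t<m. F (of_nat t * h))"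
  define S2 where "S2 = (\<Sum>t=m..<a. F (of_nat t * h))"
  have "gauss_sum a / sqrt (2 * of_nat a) - 2 * integral {0..K} F =
      2 * ((of_real h * S1 - integral {0..of_nat m * h} F) + (integral {0..of_nat m * h} F - integral {0..K} F)
       + of_real h * S2) + of_real h * (e1 (of_nat a / 4) - 1)"
    unfolding gauss_sum_half[OF apos] Fh split S1_def[symmetric] S2_def[symmetric]
    by (simp add: h_def N_def algebra_simps add_divide_distrib diff_divide_distrib)
  also have "norm \<dots> \<le> 2 * ((h * (2 * pi * (K + 1)\<^sup>2) + h) + 1 / K) + h * 2"
  proof (rule norm_triangle_le, rule add_mono)
    show "norm (2 * ((of_real h * S1 - integral {0..of_nat m * h} F) + (integral {0..of_nat m * h} F - integral {0..K} F)
       + of_real h * S2)) \<le> 2 * ((h * (2 * pi * (K + 1)\<^sup>2) + h) + 1 / K)"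
    proof -
      have "norm ((of_real h * S1 - integral {0..of_nat m * h} F) + (integral {0..of_nat m * h} F - integral {0..K} F)
          + of_real h * S2) \<le> (h * (2 * pi * (K + 1)\<^sup>2) + h) + 1 / K"
        using head' mid tail unfolding S1_def[symmetric] S2_def[symmetric] by (intro norm_triangle_mono)
      then show ?thesis by (simp add: norm_mult del: distrib_left_numeral)
    qed
    have "norm (e1 (of_nat a / 4) - 1) \<le> 2"
      using norm_triangle_ineq4[of "e1 (of_nat a / 4)" 1] by simp
    then show "norm (of_real h * (e1 (of_nat a / 4) - 1)) \<le> h * 2"
      using h by (simp add: norm_mult)
  qed
  also have "\<dots> = 2 / K + (4 * pi * (K + 1)\<^sup>2 + 4) * h"
    by (simp add: algebra_simps)
  finally show ?thesis by (simp add: h_def N_def F_def)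
qed

text \<open>
  Since \<open>gauss_sum a / sqrt (2 a)\<close> is unchanged when \<open>a\<close> is replaced by \<open>a c\<^sup>2\<close>, letting \<open>c\<close> tend to infinity turns
  it into a Fresnel integral that does not depend on \<open>a\<close>; the integral itself need not be evaluated.
\<close>

lemma gauss_sum_eq:
  assumes "a > 0"
  shows "gauss_sum a = sqrt (2 * of_nat a) * cis (pi / 4)"
proof -
  define \<gamma> where "\<gamma> a = gauss_sum a / sqrt (2 * of_nat a)" for a
  have close: "norm (\<gamma> a - 2 * integral {0..K} (\<lambda>x. e1 (x\<^sup>2 / 2))) \<le> 2 / K" if "K \<ge> 1" "a > 0" for K :: real and a
  proof -
    define b where "b c = a * c\<^sup>2" for c :: nat
    have sq: "sqrt (2 * of_nat (b c)) = of_nat c * sqrt (2 * of_nat a)" for c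
      by (simp add: b_def real_sqrt_mult)
    have \<gamma>: "\<gamma> (b c) = \<gamma> a" if "c > 0" for c
      unfolding \<gamma>_def sq using gauss_sum_mult_square[OF \<open>a > 0\<close> that] that by (simp add: b_def)
    have "(\<lambda>c. ((4 * pi * (K + 1)\<^sup>2 + 4) / sqrt (2 * of_nat a)) * (1 / of_nat c)) \<longlonglongrightarrow> 0"
      by (rule tendsto_mult_right_zero[OF lim_1_over_n])
    then have lim0: "(\<lambda>c. (4 * pi * (K + 1)\<^sup>2 + 4) / sqrt (2 * of_nat (b c))) \<longlonglongrightarrow> 0"
      unfolding sq by (simp add: mult.commute)
    have lim: "(\<lambda>c. 2 / K + (4 * pi * (K + 1)\<^sup>2 + 4) / sqrt (2 * of_nat (b c))) \<longlonglongrightarrow> 2 / K + 0"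
      by (rule tendsto_add[OF tendsto_const lim0])
    have "eventually (\<lambda>c. K * sqrt (2 * of_nat a) + 1 < of_nat c) sequentially"
      using filterlim_real_sequentially unfolding filterlim_at_top_dense by blast
    then have "eventually (\<lambda>c. norm (\<gamma> a - 2 * integral {0..K} (\<lambda>x. e1 (x\<^sup>2 / 2)))
        \<le> 2 / K + (4 * pi * (K + 1)\<^sup>2 + 4) / sqrt (2 * of_nat (b c))) sequentially"
      using eventually_gt_at_top[of 0]
    proof eventually_elim
      case (elim c)
      have "K * sqrt (2 * of_nat (b c)) + 1 < of_nat (b c)"
      proof -
        have "K * sqrt (2 * of_nat (b c)) + 1 \<le> of_nat c * (K * sqrt (2 * of_nat a) + 1)"
          unfolding sq using elim(2) by (simp add: algebra_simps)
        also have "\<dots> < of_nat c * of_nat c"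
          using elim by (intro mult_strict_left_mono) auto
        also have "\<dots> \<le> of_nat (b c)"
          using \<open>a > 0\<close> mult_right_mono[of 1 "of_nat a" "of_nat c * of_nat c :: real"]
          by (simp add: b_def power2_eq_square)
        finally show ?thesis .
      qed
      from gauss_sum_approx[OF \<open>K \<ge> 1\<close> this] show ?case
        using \<gamma>[OF elim(2)] by (simp add: \<gamma>_def)
    qed
    from tendsto_lowerbound[OF lim this] show ?thesis by simp
  qed
  \<comment> \<open>Both values lie within \<open>2 / K\<close> of the same integral, so they agree;
    the two-term sum at \<open>a = 1\<close> then supplies the constant.\<close>
  have "norm (\<gamma> a - \<gamma> 1) \<le> e" if "e > 0" for e
  proof -
    define K where "K = max 1 (4 / e)"
    have K: "K \<ge> 1" "4 / K \<le> e" using that by (auto simp: K_def field_simps max_def)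
    have "norm (\<gamma> a - \<gamma> 1) \<le> 2 / K + 2 / K"
      using norm_triangle_le_diff[OF add_mono[OF close[OF K(1) assms] close[OF K(1), of 1]]] by simp
    then show ?thesis using K by simp
  qed
  then have "norm (\<gamma> a - \<gamma> 1) \<le> 0 + e" if "e > 0" for e
    using that by simp
  then have "norm (\<gamma> a - \<gamma> 1) \<le> 0" by (rule field_le_epsilon)
  then have "\<gamma> a = \<gamma> 1" by simp
  moreover have "\<gamma> 1 = cis (pi / 4)"
  proof -
    have "gauss_sum 1 = 1 + \<i>"
      by (simp add: gauss_sum_def numeral_2_eq_2 e1_def)
    then show ?thesis
      by (simp add: \<gamma>_def complex_eq_iff cos_45 sin_45 real_div_sqrt divide_simps)
  qed
  ultimately show ?thesis
    using assms by (simp add: \<gamma>_def field_simps)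
qed

section \<open>Gauss sums modulo 5 and in a single coordinate\<close>

lemma sum_ivl_eq_nat: "(\<Sum>j\<in>{0..<int n}. f j) = (\<Sum>j<n. f (int j))"
  by (rule sum.reindex_bij_witness[of _ int nat]) auto

lemma sum_periodic_shift:
  fixes f :: "int \<Rightarrow> 'a::comm_monoid_add"
  assumes n: "n > 0" and per: "\<And>j. f (j mod n) = f j"
  shows "(\<Sum>j\<in>{0..<n}. f (j + s)) = (\<Sum>j\<in>{0..<n}. f j)"
  using n per
  by (intro sum.reindex_bij_witness[of _ "\<lambda>j. (j - s) mod n" "\<lambda>j. (j + s) mod n"]) (auto simp: mod_simps)

definition e5 :: "int \<Rightarrow> complex" where
  "e5 k = e1 (of_int k / 5)"

lemma e5_add: "e5 (j + k) = e5 j * e5 k"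
  by (simp add: e5_def add_divide_distrib e1_add)

lemma e5_0 [simp]: "e5 0 = 1"
  by (simp add: e5_def)

lemma e5_cong: "j mod 5 = k mod 5 \<Longrightarrow> e5 j = e5 k"
proof -
  assume "j mod 5 = k mod 5"
  then obtain m where "j - k = 5 * m" by (auto simp: mod_eq_dvd_iff)
  then have "(of_int j / 5 - of_int k / 5 :: real) = of_int m"
    by (simp add: diff_divide_distrib[symmetric] flip: of_int_diff)
  then show ?thesis unfolding e5_def by (intro e1_cong) simp
qed

lemma e5_sum: "e5 (\<Sum>i\<in>A. f i) = (\<Prod>i\<in>A. e5 (f i))"
  by (induction A rule: infinite_finite_induct) (auto simp: e5_add)

definition g5 :: "int \<Rightarrow> complex" where
  "g5 k = (\<Sum>j\<in>{0..<5}. e5 (k * j\<^sup>2))"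

lemma g5_shift: "(\<Sum>j\<in>{0..<5}. e5 (k * (j + s)\<^sup>2)) = g5 k"
  unfolding g5_def
proof (rule sum_periodic_shift)
  show "e5 (k * (j mod 5)\<^sup>2) = e5 (k * j\<^sup>2)" for j
    by (rule e5_cong) (metis mod_mult_right_eq power_mod)
qed simp

text \<open>The squares modulo 5 are 0, 1, 4, 4, 1; since -1 is among them, the terms pair into
  cosines. Reality at \<open>k = 3\<close> and positivity at \<open>k = 1\<close> decide the sign of
  the discriminant Gauss sum.\<close>

lemma g5_eq: "g5 k = of_real (1 + 4 * cos (2 * pi * k / 5))"
proof -
  have ivl: "{0..<5} = {0, 1, 2, 3, 4::int}" by auto
  have "e5 (k * 4) = e5 (- k)" by (rule e5_cong) (simp add: mod_eq_dvd_iff)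
  moreover have "e5 (k * 9) = e5 (- k)" by (rule e5_cong) (simp add: mod_eq_dvd_iff)
  moreover have "e5 (k * 16) = e5 k" by (rule e5_cong) (simp add: mod_eq_dvd_iff)
  ultimately have "g5 k = 1 + 2 * (e5 k + e5 (- k))"
    by (simp add: g5_def ivl)
  also have "e5 k + e5 (- k) = of_real (2 * cos (2 * pi * k / 5))"
    by (simp add: e5_def e1_def complex_eq_iff)
  finally show ?thesis by simp
qed

lemma g5_1_pos: "\<exists>x>0. g5 1 = of_real x"
proof -
  have "cos (2 * pi / 5) > 0"
    by (intro cos_gt_zero) auto
  then show ?thesis using g5_eq[of 1] by (intro exI[of _ "1 + 4 * cos (2 * pi / 5)"]) auto
qed

lemma g5_completion: "g5 1 * e5 (- (s\<^sup>2)) = (\<Sum>\<tau>\<in>{0..<5}. e5 (\<tau>\<^sup>2 + 2 * \<tau> * s))"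
proof -
  have "e5 (1 * (\<tau> + s)\<^sup>2) * e5 (- (s\<^sup>2)) = e5 (\<tau>\<^sup>2 + 2 * \<tau> * s)" for \<tau>
    by (simp add: power2_eq_square algebra_simps flip: e5_add)
  then show ?thesis
    unfolding g5_shift[of 1 s, symmetric] by (simp add: sum_distrib_right)
qed

text \<open>The square of the total is linearised by completing the square with an auxiliary variable \<open>\<tau>\<close>.\<close>

lemma block_gauss_sum:
  fixes c :: "'b \<Rightarrow> int"
  assumes "finite B" and card: "card B = 9"
  shows "(\<Sum>d\<in>PiE B (\<lambda>_. {0..<5}). e5 (3 * (\<Sum>b\<in>B. (c b + d b)\<^sup>2) - (\<Sum>b\<in>B. c b + d b)\<^sup>2)) = g5 3 ^ 10 / g5 1"
proof -
  \<comment> \<open>The inverse of 3 modulo 5 is 2, so \<open>3 u\<^sup>2 + 2 \<tau> u\<close> is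
    congruent to \<open>3 (u + 2 \<tau>)\<^sup>2 - 2 \<tau>\<^sup>2\<close>.\<close>
  have inner: "(\<Sum>d\<in>{0..<5}. e5 (3 * (c b + d)\<^sup>2 + 2 * \<tau> * (c b + d))) = e5 (- 2 * \<tau>\<^sup>2) * g5 3" for b \<tau>
  proof -
    have "e5 (3 * (c b + d)\<^sup>2 + 2 * \<tau> * (c b + d)) = e5 (- 2 * \<tau>\<^sup>2) * e5 (3 * (d + (c b + 2 * \<tau>))\<^sup>2)" for d
      unfolding e5_add[symmetric]
    proof (rule e5_cong)
      have "3 * (c b + d)\<^sup>2 + 2 * \<tau> * (c b + d) - (- 2 * \<tau>\<^sup>2 + 3 * (d + (c b + 2 * \<tau>))\<^sup>2) =
          5 * (- 2 * \<tau> * (c b + d) - 2 * \<tau>\<^sup>2)"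
        by (simp add: power2_eq_square algebra_simps)
      then show "(3 * (c b + d)\<^sup>2 + 2 * \<tau> * (c b + d)) mod 5 = (- 2 * \<tau>\<^sup>2 + 3 * (d + (c b + 2 * \<tau>))\<^sup>2) mod 5"
        unfolding mod_eq_dvd_iff by (metis dvd_triv_left)
    qed
    then show ?thesis by (simp add: g5_shift flip: sum_distrib_left)
  qed
  let ?P = "PiE B (\<lambda>_. {0..<5::int})"
  have "g5 1 * (\<Sum>d\<in>?P. e5 (3 * (\<Sum>b\<in>B. (c b + d b)\<^sup>2) - (\<Sum>b\<in>B. c b + d b)\<^sup>2)) =
      (\<Sum>d\<in>?P. e5 (3 * (\<Sum>b\<in>B. (c b + d b)\<^sup>2)) * (g5 1 * e5 (- ((\<Sum>b\<in>B. c b + d b)\<^sup>2))))"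
    by (simp add: sum_distrib_left mult_ac flip: e5_add)
  also have "\<dots> = (\<Sum>d\<in>?P. \<Sum>\<tau>\<in>{0..<5}. e5 (\<tau>\<^sup>2) * (\<Prod>b\<in>B. e5 (3 * (c b + d b)\<^sup>2 + 2 * \<tau> * (c b + d b))))"
  proof (rule sum.cong[OF refl])
    fix d :: "'b \<Rightarrow> int"
    have "e5 (3 * (\<Sum>b\<in>B. (c b + d b)\<^sup>2)) * e5 (\<tau>\<^sup>2 + 2 * \<tau> * (\<Sum>b\<in>B. c b + d b)) =
        e5 (\<tau>\<^sup>2) * (\<Prod>b\<in>B. e5 (3 * (c b + d b)\<^sup>2 + 2 * \<tau> * (c b + d b)))" for \<tau>
      unfolding e5_sum[symmetric] e5_add[symmetric] sum.distrib sum_distrib_left[symmetric]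
      by (simp add: algebra_simps)
    then show "e5 (3 * (\<Sum>b\<in>B. (c b + d b)\<^sup>2)) * (g5 1 * e5 (- ((\<Sum>b\<in>B. c b + d b)\<^sup>2))) =
        (\<Sum>\<tau>\<in>{0..<5}. e5 (\<tau>\<^sup>2) * (\<Prod>b\<in>B. e5 (3 * (c b + d b)\<^sup>2 + 2 * \<tau> * (c b + d b))))"
      unfolding g5_completion sum_distrib_left by simp
  qed
  also have "\<dots> = (\<Sum>\<tau>\<in>{0..<5}. e5 (\<tau>\<^sup>2) * (\<Sum>d\<in>?P. \<Prod>b\<in>B. e5 (3 * (c b + d b)\<^sup>2 + 2 * \<tau> * (c b + d b))))"
    unfolding sum_distrib_left by (rule sum.swap)
  also have "\<dots> = (\<Sum>\<tau>\<in>{0..<5}. e5 (\<tau>\<^sup>2) * (\<Prod>b\<in>B. e5 (- 2 * \<tau>\<^sup>2) * g5 3))"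
  proof -
    have "(\<Sum>d\<in>?P. \<Prod>b\<in>B. e5 (3 * (c b + d b)\<^sup>2 + 2 * \<tau> * (c b + d b))) = (\<Prod>b\<in>B. e5 (- 2 * \<tau>\<^sup>2) * g5 3)" for \<tau>
      using prod_sum_PiE[OF \<open>finite B\<close>, of "\<lambda>_. {0..<5}" "\<lambda>b d. e5 (3 * (c b + d)\<^sup>2 + 2 * \<tau> * (c b + d))"]
      by (simp only: inner finite_atLeastLessThan_int)
    then show ?thesis by (simp only:)
  qed
  \<comment> \<open>The coefficient of \<open>\<tau>\<^sup>2\<close> is 1 - 2 * 9 = -17, which is 3
    modulo 5, so the sum over \<open>\<tau>\<close> is a tenth factor \<open>g5 3\<close>.\<close>
  also have "\<dots> = (\<Sum>\<tau>\<in>{0..<5}. e5 (3 * \<tau>\<^sup>2) * g5 3 ^ 9)"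
  proof (rule sum.cong[OF refl])
    fix \<tau> :: int
    have "e5 (\<tau>\<^sup>2) * (\<Prod>b\<in>B. e5 (- 2 * \<tau>\<^sup>2)) = e5 (\<tau>\<^sup>2 + (\<Sum>b\<in>B. - 2 * \<tau>\<^sup>2))"
      by (simp only: e5_add e5_sum)
    also have "\<dots> = e5 (3 * \<tau>\<^sup>2)"
      by (rule e5_cong) (simp add: card mod_eq_dvd_iff)
    finally show "e5 (\<tau>\<^sup>2) * (\<Prod>b\<in>B. e5 (- 2 * \<tau>\<^sup>2) * g5 3) = e5 (3 * \<tau>\<^sup>2) * g5 3 ^ 9"
      by (simp add: prod.distrib card power_mult_distrib flip: mult.assoc)
  qed
  also have "\<dots> = g5 3 ^ 10"
    unfolding sum_distrib_right[symmetric] g5_def[symmetric] by (simp flip: power_Suc)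
  finally show ?thesis using g5_1_pos by (auto simp: field_simps)
qed

text \<open>The exponent comes out even because the form \<open>3 I - J\<close> on nine block sums
  has determinant 3^8 * (3 - 9), a square modulo 5. As \<open>g5 3\<close> is negative, an odd
  exponent would give the opposite sign.\<close>

lemma block_gauss_value_nonneg: "\<exists>x\<ge>0. g5 3 ^ 10 / g5 1 = of_real x"
proof -
  obtain x where x: "x > 0" "g5 1 = of_real x" using g5_1_pos by blast
  obtain y :: real where y: "g5 3 = of_real y" unfolding g5_eq by blast
  have "0 \<le> y ^ 10 / x" using x by simp
  then show ?thesis using x y by (intro exI[of _ "y ^ 10 / x"]) simp
qed

text \<open>Conjugation turns the sign of \<open>a\<close> into the sign of the argument. The range
  covers \<open>m\<close> periods because all coordinates of the lattice sum will share one
  modulus.\<close>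

lemma sum_e1_square:
  fixes a m :: int
  assumes a: "a \<noteq> 0" and m: "m > 0"
  shows "\<exists>R>0. (\<Sum>t\<in>{0..<2 * \<bar>a\<bar> * m}. e1 (of_int (t\<^sup>2) / (4 * of_int a))) = of_real R * cis (pi / 4 * sgn (of_int a))"
proof -
  define b where "b = nat \<bar>a\<bar>"
  define k where "k = nat m"
  have b: "b > 0" "\<bar>a\<bar> = int b" and k: "k > 0" "m = int k"
    using a m by (auto simp: b_def k_def)
  define f where "f t = e1 ((of_nat t)\<^sup>2 / (4 * of_nat b))" for t :: nat
  have per: "f (u + j * (2 * b)) = f u" for u j
    unfolding f_def
  proof (rule e1_cong)
    have "(of_nat (u + j * (2 * b)))\<^sup>2 / (4 * of_nat b) - (of_nat u)\<^sup>2 / (4 * of_nat b) = (of_nat (j * u + b * j\<^sup>2) :: real)"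
      using b by (simp add: field_simps power2_eq_square)
    then show "(of_nat (u + j * (2 * b)))\<^sup>2 / (4 * of_nat b) - (of_nat u)\<^sup>2 / (4 * of_nat b) \<in> (\<int> :: real set)"
      by (simp only: Ints_of_nat)
  qed
  have "(\<Sum>t<k * (2 * b). f t) = (\<Sum>j<k. \<Sum>t\<in>{j * (2 * b)..<j * (2 * b) + 2 * b}. f t)"
    by (rule sum.nat_group[symmetric])
  also have "\<dots> = (\<Sum>j<k. \<Sum>u<2 * b. f (u + j * (2 * b)))"
  proof (rule sum.cong[OF refl])
    fix j
    show "(\<Sum>t\<in>{j * (2 * b)..<j * (2 * b) + 2 * b}. f t) = (\<Sum>u<2 * b. f (u + j * (2 * b)))"
      using sum.shift_bounds_nat_ivl[of f 0 "j * (2 * b)" "2 * b"]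
      by (simp add: add.commute atLeast0LessThan)
  qed
  also have "\<dots> = of_nat k * gauss_sum b"
    unfolding per gauss_sum_def f_def[symmetric] by simp
  finally have sum_f: "(\<Sum>t<k * (2 * b). f t) = of_real (of_nat k * sqrt (2 * of_nat b)) * cis (pi / 4)"
    by (simp add: gauss_sum_eq[OF b(1)])
  define R where "R = of_nat k * sqrt (2 * of_nat b)"
  have R: "R > 0" using b k by (simp add: R_def)
  have ivl: "2 * \<bar>a\<bar> * m = int (k * (2 * b))" by (simp add: b k)
  show ?thesis
  proof (cases "a > 0")
    case True
    then have "a = int b" using b by simp
    then have "(\<Sum>t\<in>{0..<2 * \<bar>a\<bar> * m}. e1 (of_int (t\<^sup>2) / (4 * of_int a))) = (\<Sum>t<k * (2 * b). f t)"
      unfolding ivl sum_ivl_eq_nat by (simp add: f_def)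
    then show ?thesis using R True unfolding sum_f R_def[symmetric] by auto
  next
    case False
    then have ab: "a = - int b" using b by simp
    have "e1 (of_int ((int t)\<^sup>2) / (4 * of_int a)) = cnj (f t)" for t
      by (simp add: f_def e1_def cis_cnj ab)
    then have "(\<Sum>t\<in>{0..<2 * \<bar>a\<bar> * m}. e1 (of_int (t\<^sup>2) / (4 * of_int a))) = cnj (\<Sum>t<k * (2 * b). f t)"
      unfolding ivl sum_ivl_eq_nat by simp
    also have "\<dots> = of_real R * cis (- (pi / 4))"
      unfolding sum_f R_def[symmetric] by (simp add: cis_cnj)
    finally show ?thesis using R False a by (intro exI[of _ R]) simp
  qed
qed


section \<open>Character sums over integer boxes, with rational phases\<close>

lemma sum_box_shift:
  fixes F :: "('i \<Rightarrow> int) \<Rightarrow> 'a::comm_monoid_add"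
  assumes n: "n > 0" and per: "\<And>t t'. (\<And>i. i \<in> I \<Longrightarrow> t i mod n = t' i mod n) \<Longrightarrow> F t = F t'"
  shows "(\<Sum>t\<in>PiE I (\<lambda>_. {0..<n}). F (\<lambda>i. t i + s i)) = (\<Sum>t\<in>PiE I (\<lambda>_. {0..<n}). F t)"
proof (rule sum.reindex_bij_witness[of _ "\<lambda>t. restrict (\<lambda>i. (t i - s i) mod n) I" "\<lambda>t. restrict (\<lambda>i. (t i + s i) mod n) I"])
  fix t assume t: "t \<in> PiE I (\<lambda>_. {0..<n})"
  show "restrict (\<lambda>i. (restrict (\<lambda>i. (t i + s i) mod n) I i - s i) mod n) I = t"
    using t by (intro ext) (auto simp: restrict_def mod_simps PiE_def Pi_def extensional_def)
  show "restrict (\<lambda>i. (restrict (\<lambda>i. (t i - s i) mod n) I i + s i) mod n) I = t"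
    using t by (intro ext) (auto simp: restrict_def mod_simps PiE_def Pi_def extensional_def)
  show "restrict (\<lambda>i. (t i + s i) mod n) I \<in> PiE I (\<lambda>_. {0..<n})" "restrict (\<lambda>i. (t i - s i) mod n) I \<in> PiE I (\<lambda>_. {0..<n})"
    using n by auto
  show "F (restrict (\<lambda>i. (t i + s i) mod n) I) = F (\<lambda>i. t i + s i)"
    by (rule per) simp
qed

definition er :: "rat \<Rightarrow> complex" where
  "er q = e1 (of_rat q)"

lemma er_add: "er (p + q) = er p * er q"
  by (simp add: er_def of_rat_add e1_add)

lemma er_0 [simp]: "er 0 = 1"
  by (simp add: er_def)

lemma er_Ints: "q \<in> \<int> \<Longrightarrow> er q = 1"
  unfolding er_def by (rule e1_Ints) (auto elim!: Ints_cases)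

lemma er_cong: "p - q \<in> \<int> \<Longrightarrow> er p = er q"
  using er_add[of q "p - q"] by (simp add: er_Ints)

lemma er_sum: "er (\<Sum>i\<in>A. f i) = (\<Prod>i\<in>A. er (f i))"
  by (induction A rule: infinite_finite_induct) (auto simp: er_add)

lemma er_of_int_div_5: "er (of_int k / 5) = e5 k"
  by (simp add: er_def e5_def of_rat_divide)

lemma sum_er_character:
  assumes "of_nat c * x \<in> \<int>"
  shows "(\<Sum>j<c. er (of_nat j * x)) = (if x \<in> \<int> then of_nat c else 0)"
proof -
  have "(of_nat c * of_rat x :: real) \<in> \<int>"
    using assms by (metis Ints_cases Ints_of_int of_rat_mult of_rat_of_int_eq of_rat_of_nat_eq)
  moreover have "(of_rat x :: real) \<in> \<int> \<longleftrightarrow> x \<in> \<int>"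
    by (metis Ints_cases Ints_of_int of_rat_eq_iff of_rat_of_int_eq)
  ultimately show ?thesis
    using sum_e1_character[of c "of_rat x"] by (simp add: er_def of_rat_mult)
qed

text \<open>Multiplication by \<open>er (j * h p t)\<close> stays inside the family
  \<open>G\<close>, whose members all have the sum \<open>\<Phi>\<close>. Averaging over
  \<open>j < D\<close> thus preserves \<open>\<Phi>\<close> while deleting every \<open>t\<close>
  with \<open>h p t\<close> not integral. The conditions in \<open>S\<close> are imposed one at a
  time.\<close>

lemma sum_restrict_characters:
  fixes h :: "'p \<Rightarrow> 't \<Rightarrow> rat" and G :: "'m \<Rightarrow> 't \<Rightarrow> complex"
  assumes fin: "finite T" "finite S" and D: "D > 0" "\<And>p t. p \<in> S \<Longrightarrow> t \<in> T \<Longrightarrow> of_nat D * h p t \<in> \<int>"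
    and sum: "\<And>m. m \<in> M \<Longrightarrow> (\<Sum>t\<in>T. G m t) = \<Phi>"
    and closed: "\<And>m p j. m \<in> M \<Longrightarrow> p \<in> S \<Longrightarrow> \<exists>m'\<in>M. \<forall>t\<in>T. G m t * er (of_nat j * h p t) = G m' t"
    and "m \<in> M"
  shows "(\<Sum>t\<in>{t\<in>T. \<forall>p\<in>S. h p t \<in> \<int>}. G m t) = \<Phi>"
  using fin(2) D(2) closed \<open>m \<in> M\<close>
proof (induction S arbitrary: m rule: finite_induct)
  case empty
  then show ?case using sum by simp
next
  case (insert p S)
  let ?T = "{t\<in>T. \<forall>p\<in>S. h p t \<in> \<int>}"
  have IH: "(\<Sum>t\<in>?T. G m t) = \<Phi>" if "m \<in> M" for m
    using insert.prems that by (intro insert.IH) auto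
  have sum_j: "(\<Sum>t\<in>?T. G m t * er (of_nat j * h p t)) = \<Phi>" for j
  proof -
    obtain m' where m': "m' \<in> M" "\<And>t. t \<in> T \<Longrightarrow> G m t * er (of_nat j * h p t) = G m' t"
      using insert.prems(2)[OF insert.prems(3), of p j] by auto
    have "(\<Sum>t\<in>?T. G m t * er (of_nat j * h p t)) = (\<Sum>t\<in>?T. G m' t)"
      using m'(2) by (intro sum.cong) auto
    then show ?thesis using IH[OF m'(1)] by simp
  qed
  have "of_nat D * (\<Sum>t\<in>{t\<in>T. \<forall>p\<in>insert p S. h p t \<in> \<int>}. G m t) =
      (\<Sum>t\<in>?T. if h p t \<in> \<int> then of_nat D * G m t else 0)"
    using fin(1) by (simp add: sum_distrib_left flip: sum.inter_filter) (rule sum.cong, auto)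
  also have "\<dots> = (\<Sum>t\<in>?T. G m t * (\<Sum>j<D. er (of_nat j * h p t)))"
    using insert.prems(1) by (intro sum.cong) (auto simp: sum_er_character)
  also have "\<dots> = (\<Sum>j<D. \<Sum>t\<in>?T. G m t * er (of_nat j * h p t))"
    unfolding sum_distrib_left by (rule sum.swap)
  also have "\<dots> = of_nat D * \<Phi>"
    by (simp add: sum_j)
  finally show ?case using D(1) by simp
qed

lemma common_denominator:
  fixes S :: "rat set"
  assumes "finite S"
  shows "\<exists>D::nat. D > 0 \<and> (\<forall>x\<in>S. of_nat D * x \<in> \<int>)"
  using assms
proof induction
  case (insert x S)
  then obtain D :: nat where D: "D > 0" "\<And>y. y \<in> S \<Longrightarrow> of_nat D * y \<in> \<int>" by auto
  obtain a b where x: "x = of_int a / of_int b" "b > 0"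
    by (cases x) (auto simp: Fract_of_int_quotient)
  define b' where "b' = nat b"
  have b': "of_int b = (of_nat b' :: rat)" "b' > 0" using x by (simp_all add: b'_def)
  have "of_nat (D * b') * x = of_int (int D * a)"
    using x b' by simp
  moreover have "of_nat (D * b') * y \<in> \<int>" if "y \<in> S" for y
    using Ints_mult[OF D(2)[OF that] Ints_of_nat[of b']] by (simp add: mult_ac)
  ultimately show ?case using D(1) b'(2)
    by (intro exI[of _ "D * b'"]) (auto simp del: of_nat_mult)
qed auto

lemma even_symmetric_sum:
  fixes s :: "'a \<Rightarrow> 'a \<Rightarrow> int"
  assumes "finite S" and sym: "\<And>a b. s a b = s b a" and diag: "\<And>a. even (s a a)"
  shows "even (\<Sum>a\<in>S. \<Sum>b\<in>S. s a b)"
  using assms(1)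
proof induction
  case (insert x S)
  have "(\<Sum>a\<in>S. s a x) = (\<Sum>b\<in>S. s x b)" by (rule sum.cong) (auto intro: sym)
  then show ?case using insert diag[of x] by (simp add: sum.distrib)
qed simp

subsection \<open>Symmetric bilinear forms over a field\<close>

definition dot :: "'a::comm_ring_1 ^ 'n::finite \<Rightarrow> 'a ^ 'n \<Rightarrow> 'a" where
  "dot x y = (\<Sum>i\<in>UNIV. x $ i * y $ i)"

lemma dot_commute: "dot x y = dot y x"
  by (simp add: dot_def mult.commute)

lemma dot_simps [simp]:
  "dot (x + y) z = dot x z + dot y z" "dot z (x + y) = dot z x + dot z y"
  "dot (x - y) z = dot x z - dot y z" "dot z (x - y) = dot z x - dot z y"
  "dot (c *s x) z = c * dot x z" "dot z (c *s x) = c * dot z x"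
  "dot 0 z = 0" "dot z 0 = 0"
  by (simp_all add: dot_def algebra_simps sum.distrib sum_subtractf sum_distrib_left)

lemma dot_sum_left: "dot (\<Sum>i\<in>I. f i) z = (\<Sum>i\<in>I. dot (f i) z)"
  by (induction I rule: infinite_finite_induct) auto

lemma dot_sum_right: "dot z (\<Sum>i\<in>I. f i) = (\<Sum>i\<in>I. dot z (f i))"
  by (induction I rule: infinite_finite_induct) auto

lemma dot_matrix_vector: "dot x (A *v y) = dot (transpose A *v x) y"
  unfolding dot_def matrix_vector_mult_def transpose_def
  by (simp add: sum_distrib_left sum_distrib_right) (subst sum.swap, simp add: mult_ac)

lemma dot_axis [simp]: "dot (axis i 1) x = x $ i" "dot x (axis i 1) = x $ i"
  by (simp_all add: dot_def axis_def if_distrib if_distribR cong: if_cong)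

lemma dot_eq_0_imp: "(\<And>y. dot x y = 0) \<Longrightarrow> x = 0"
  by (metis dot_axis(2) vec_eq_iff zero_index)

lemma dot_self_eq_0_iff [simp]: "dot x x = 0 \<longleftrightarrow> x = (0 :: 'a::linordered_idom ^ 'n)"
  by (auto simp: dot_def sum_nonneg_eq_0_iff vec_eq_iff)

lemma dot_self_nonneg [simp]: "0 \<le> dot x (x :: 'a::linordered_idom ^ 'n)"
  by (simp add: dot_def sum_nonneg)

lemma matrix_mult_diff_distrib:
  fixes M N :: "'a::ring_1 ^ 'm ^ 'n"
  shows "(M - N) ** K = M ** K - N ** K" "L ** (M - N) = L ** M - L ** N"
  by (simp_all add: matrix_matrix_mult_def vec_eq_iff sum_subtractf algebra_simps)

lemma matrix_vector_mult_axis: "(A *v axis j 1) $ i = A $ i $ j"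
  by (simp add: matrix_vector_mult_def axis_def if_distrib cong: if_cong)

text \<open>\<open>S\<close> may be indefinite, so Gram-Schmidt could run into isotropic vectors. An
  orthogonal set \<open>B\<close> of non-isotropic vectors of maximal size avoids this: the residues
  \<open>pr y\<close> are then all isotropic, hence orthogonal to each other by polarisation, and
  nondegeneracy makes them vanish.\<close>

lemma congruent_diagonal:
  fixes S :: "'a::field_char_0 ^ 'n ^ 'n"
  assumes sym: "transpose S = S" and nondeg: "\<forall>x. S *v x = 0 \<longrightarrow> x = 0"
  obtains p w where "\<And>i j. dot (p i) (S *v p j) = (if i = j then w i else 0)" "\<And>i::'n. w i \<noteq> 0"
    "\<And>y. y = (\<Sum>i\<in>UNIV. (dot (p i) (S *v y) / w i) *s p i)"
proof -
  define \<beta> where "\<beta> x y = dot x (S *v y)" for x y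
  have bsym: "\<beta> x y = \<beta> y x" for x y
    unfolding \<beta>_def by (metis dot_commute dot_matrix_vector sym)
  have badd: "\<beta> (x + y) z = \<beta> x z + \<beta> y z" "\<beta> (x - y) z = \<beta> x z - \<beta> y z" "\<beta> (c *s x) z = c * \<beta> x z"
      "\<beta> (\<Sum>i\<in>I. f i) z = (\<Sum>i\<in>I. \<beta> (f i) z)" for x y z c I and f :: "'a ^ 'n \<Rightarrow> 'a ^ 'n"
    by (simp_all add: \<beta>_def dot_sum_left)
  have badd2: "\<beta> z (x + y) = \<beta> z x + \<beta> z y" "\<beta> z (x - y) = \<beta> z x - \<beta> z y" for x y z
    using badd bsym by metis+
  define orth where "orth B \<longleftrightarrow> (\<forall>x\<in>B. \<beta> x x \<noteq> 0) \<and> (\<forall>x\<in>B. \<forall>y\<in>B. x \<noteq> y \<longrightarrow> \<beta> x y = 0)" for B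
  have coef: "\<beta> (\<Sum>x\<in>B. u x *s x) b = u b * \<beta> b b" if "orth B" "finite B" "b \<in> B" for B u b
  proof -
    have "\<beta> (\<Sum>x\<in>B. u x *s x) b = (\<Sum>x\<in>B. u x * \<beta> x b)" by (simp add: badd)
    also have "\<dots> = (\<Sum>x\<in>B. if x = b then u b * \<beta> b b else 0)"
      using that by (intro sum.cong) (auto simp: orth_def)
    finally show ?thesis using that by simp
  qed
  have indep: "vec.independent B" if "orth B" for B
    unfolding vec.dependent_explicit
  proof clarify
    fix t u v assume t: "finite t" "t \<subseteq> B" "(\<Sum>v\<in>t. u v *s v) = 0" "v \<in> t" "u v \<noteq> 0"
    have "orth t" using that t(2) by (auto simp: orth_def)
    from coef[OF this t(1) t(4), of u] have "u v * \<beta> v v = 0" using t(3) by (simp add: \<beta>_def)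
    then show False using t \<open>orth t\<close> by (auto simp: orth_def)
  qed
  have bound: "finite B \<and> card B \<le> CARD('n)" if "orth B" for B
    using vec.independent_bound_general[OF indep[OF that]] vec.dim_subset_UNIV[of B] by (auto simp: card_cart_basis vec.dimension_def intro: order_trans)
  have "\<exists>B. orth B \<and> (\<forall>B'. orth B' \<longrightarrow> card B' \<le> card B)"
    using ex_has_greatest_nat[of orth "{}" card "Suc CARD('n)"] bound by (auto simp: orth_def less_Suc_eq_le)
  then obtain B where B: "orth B" and max: "\<And>B'. orth B' \<Longrightarrow> card B' \<le> card B" by blast
  have fin: "finite B" using bound B by blast
  define pr where "pr y = y - (\<Sum>b\<in>B. (\<beta> y b / \<beta> b b) *s b)" for y
  have pr: "\<beta> (pr y) b = 0" if "b \<in> B" for y b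
    using coef[OF B fin that, of "\<lambda>b. \<beta> y b / \<beta> b b"] B that by (simp add: pr_def badd orth_def)
  have iso: "\<beta> x x = 0" if "\<And>b. b \<in> B \<Longrightarrow> \<beta> x b = 0" for x
  proof (rule ccontr)
    assume nz: "\<beta> x x \<noteq> 0"
    have "orth (insert x B)" using B nz that bsym by (auto simp: orth_def)
    moreover have "x \<notin> B" using that nz by blast
    ultimately show False using max[of "insert x B"] fin by simp
  qed
  have pr0: "pr y = 0" for y
  proof (rule nondeg[rule_format], rule dot_eq_0_imp)
    fix z
    have "\<beta> (pr y + pr z) (pr y + pr z) = 0" "\<beta> (pr y) (pr y) = 0" "\<beta> (pr z) (pr z) = 0"
      by (intro iso; simp add: badd pr)+
    then have "2 * \<beta> (pr y) (pr z) = 0" unfolding badd badd2 using bsym[of "pr z" "pr y"] by simp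
    then have "\<beta> (pr y) (pr z) = 0" by simp
    moreover have "\<beta> z (pr y) = \<beta> (pr z) (pr y) + (\<Sum>b\<in>B. (\<beta> z b / \<beta> b b) * \<beta> b (pr y))"
      by (simp add: pr_def[of z] badd)
    moreover have "\<beta> (pr z) (pr y) = 0" using \<open>\<beta> (pr y) (pr z) = 0\<close> bsym[of "pr y" "pr z"] by simp
    moreover have "\<beta> b (pr y) = 0" if "b \<in> B" for b using pr[OF that, of y] bsym[of b "pr y"] by simp
    ultimately have "\<beta> z (pr y) = 0" by simp
    then show "dot (S *v pr y) z = 0" using dot_commute[of z "S *v pr y"] by (simp add: \<beta>_def)
  qed
  have expand: "y = (\<Sum>b\<in>B. (\<beta> y b / \<beta> b b) *s b)" for y
    using pr0[of y] by (simp add: pr_def)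
  have "(\<Sum>b\<in>B. (\<beta> y b / \<beta> b b) *s b) \<in> vec.span B" for y
    by (intro vec.span_sum vec.span_scale vec.span_base)
  then have "y \<in> vec.span B" for y by (subst expand)
  then have "CARD('n) \<le> card B"
    using vec.dim_le_card[of "UNIV :: ('a ^ 'n) set" B] fin by (auto simp: card_cart_basis)
  then have "card B = CARD('n)" using bound[OF B] by simp
  then obtain p where p: "bij_betw p (UNIV :: 'n set) B"
    using finite_same_card_bij[of "UNIV :: 'n set" B] fin by auto
  have "dot (p i) (S *v p j) = (if i = j then \<beta> (p i) (p i) else 0)" "\<beta> (p i) (p i) \<noteq> 0" for i j
  proof -
    have inB: "p i \<in> B" "p j \<in> B" and "p i = p j \<longleftrightarrow> i = j"
      using p by (auto simp: bij_betw_def inj_eq)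
    then have "\<beta> (p i) (p j) = (if i = j then \<beta> (p i) (p i) else 0)"
      using B by (simp add: orth_def)
    then show "dot (p i) (S *v p j) = (if i = j then \<beta> (p i) (p i) else 0)" by (simp add: \<beta>_def)
    show "\<beta> (p i) (p i) \<noteq> 0" using B inB by (simp add: orth_def)
  qed
  moreover have "y = (\<Sum>i\<in>UNIV. (dot (p i) (S *v y) / \<beta> (p i) (p i)) *s p i)" for y
  proof -
    have "y = (\<Sum>b\<in>B. (\<beta> b y / \<beta> b b) *s b)"
      unfolding bsym[of _ y] by (rule expand)
    also have "\<dots> = (\<Sum>i\<in>UNIV. (\<beta> (p i) y / \<beta> (p i) (p i)) *s p i)"
      by (rule sum.reindex_bij_betw[OF p, symmetric])
    finally show ?thesis by (simp add: \<beta>_def)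
  qed
  ultimately show ?thesis by (rule that[of p "\<lambda>i. \<beta> (p i) (p i)"])
qed

text \<open>Used for signs: if the weights are nonzero, their product has the sign of
  \<open>det S\<close>.\<close>

lemma det_congruent_diagonal:
  assumes "\<And>i j. dot (p i) (S *v p j) = (if i = j then w i else 0)"
  shows "det S * (det (\<chi> i j. p j $ i))\<^sup>2 = (\<Prod>i\<in>UNIV. w i)"
proof -
  define P where "P = (\<chi> i j. p j $ i)"
  have col: "P *v axis j 1 = p j" for j
    by (simp add: P_def vec_eq_iff matrix_vector_mult_axis)
  have "(transpose P ** (S ** P)) $ i $ j = (if i = j then w i else 0)" for i j
  proof -
    have "(transpose P ** (S ** P)) $ i $ j = dot (axis i 1) ((transpose P ** (S ** P)) *v axis j 1)"
      by (simp add: matrix_vector_mult_axis)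
    also have "\<dots> = dot (P *v axis i 1) (S *v (P *v axis j 1))"
      by (simp only: matrix_vector_mul_assoc[symmetric] dot_matrix_vector[of _ "transpose P"] transpose_transpose)
    finally show ?thesis using assms by (simp add: col)
  qed
  then have "det (transpose P ** (S ** P)) = (\<Prod>i\<in>UNIV. w i)"
    by (subst det_diagonal) auto
  then show ?thesis by (simp add: det_mul det_transpose P_def power2_eq_square mult_ac)
qed

subsection \<open>The Bose--Mesner algebra\<close>

text \<open>
  The polynomial is the norm of \<open>a + b \<theta> + c \<theta>\<^sup>2\<close>, where \<open>\<theta>\<^sup>3 = 12 \<theta> - 14\<close>. Since the cubic is Eisenstein
  at 2, a zero of the norm form is divisible by 2.
\<close>

lemma norm_form_descent:
  fixes a b c :: int
  assumes "a ^ 3 - 14 * b ^ 3 + 196 * c ^ 3 + 24 * a\<^sup>2 * c + 144 * a * c\<^sup>2 - 12 * a * b\<^sup>2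
    + 42 * a * b * c + 168 * b * c\<^sup>2 = 0"
  shows "a = 0 \<and> b = 0 \<and> c = 0"
  using assms
proof (induction "nat (\<bar>a\<bar> + \<bar>b\<bar> + \<bar>c\<bar>)" arbitrary: a b c rule: less_induct)
  case less
  have "even (a ^ 3)"
  proof -
    have "even (a ^ 3 - 14 * b ^ 3 + 196 * c ^ 3 + 24 * a\<^sup>2 * c + 144 * a * c\<^sup>2 - 12 * a * b\<^sup>2
      + 42 * a * b * c + 168 * b * c\<^sup>2)" using less.prems by simp
    then show ?thesis by auto
  qed
  then obtain a' where a: "a = 2 * a'" by auto
  \<comment> \<open>Halving leaves 7 as the only odd coefficient, at the cube of \<open>b\<close>;
    the next halving leaves 49, at the cube of \<open>c\<close>. So all three variables are even in
    turn.\<close>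
  have "4 * a' ^ 3 - 7 * b ^ 3 + 98 * c ^ 3 + 48 * a'\<^sup>2 * c + 144 * a' * c\<^sup>2 - 12 * a' * b\<^sup>2
    + 42 * a' * b * c + 84 * b * c\<^sup>2 = 0"
    using less.prems by (simp add: a power2_eq_square power3_eq_cube)
  then have "even (4 * a' ^ 3 - 7 * b ^ 3 + 98 * c ^ 3 + 48 * a'\<^sup>2 * c + 144 * a' * c\<^sup>2 - 12 * a' * b\<^sup>2
    + 42 * a' * b * c + 84 * b * c\<^sup>2)" by simp
  then obtain b' where b: "b = 2 * b'" by auto
  have "2 * a' ^ 3 - 28 * b' ^ 3 + 49 * c ^ 3 + 24 * a'\<^sup>2 * c + 72 * a' * c\<^sup>2 - 24 * a' * b'\<^sup>2
    + 42 * a' * b' * c + 84 * b' * c\<^sup>2 = 0"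
    using less.prems by (simp add: a b power2_eq_square power3_eq_cube)
  then have "even (2 * a' ^ 3 - 28 * b' ^ 3 + 49 * c ^ 3 + 24 * a'\<^sup>2 * c + 72 * a' * c\<^sup>2 - 24 * a' * b'\<^sup>2
    + 42 * a' * b' * c + 84 * b' * c\<^sup>2)" by simp
  then obtain c' where c: "c = 2 * c'" by auto
  have eq: "a' ^ 3 - 14 * b' ^ 3 + 196 * c' ^ 3 + 24 * a'\<^sup>2 * c' + 144 * a' * c'\<^sup>2 - 12 * a' * b'\<^sup>2
    + 42 * a' * b' * c' + 168 * b' * c'\<^sup>2 = 0"
    using less.prems by (simp add: a b c power2_eq_square power3_eq_cube)
  show ?case
  proof (rule ccontr)
    assume "\<not> ?case"
    then have "nat (\<bar>a'\<bar> + \<bar>b'\<bar> + \<bar>c'\<bar>) < nat (\<bar>a\<bar> + \<bar>b\<bar> + \<bar>c\<bar>)" by (auto simp: a b c)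
    from less.hyps[OF this eq] \<open>\<not> ?case\<close> show False by (simp add: a b c)
  qed
qed

text \<open>Labelling the pairs over a finite type by their relation makes the adjacency matrices
  members of \<open>rat ^ 'n ^ 'n\<close>.\<close>

locale scheme =
  fixes r :: "'n::finite \<Rightarrow> 'n \<Rightarrow> nat"
  assumes r_le: "r x y < 5"
    and r_0: "r x y = 0 \<longleftrightarrow> x = y"
    and r_sym: "r x y = r y x"
    and r_card: "i < 5 \<Longrightarrow> j < 5 \<Longrightarrow> card {z. r x z = i \<and> r z y = j} = intersection_matrices ! r x y ! i ! j"
begin

text \<open>The list \<open>[a\<^sub>0, \<dots>, a\<^sub>4]\<close> stands for the combination \<open>a\<^sub>0 A\<^sub>0 + \<dots> + a\<^sub>4 A\<^sub>4\<close> of the adjacency matrices.\<close>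

definition bm :: "rat list \<Rightarrow> rat ^ 'n ^ 'n" where
  "bm a = (\<chi> x y. a ! r x y)"

lemma bm_mult_entry:
  "(bm a ** bm b) $ x $ y = (\<Sum>i<5. \<Sum>j<5. a ! i * b ! j * of_nat (intersection_matrices ! r x y ! i ! j))"
proof -
  have "(bm a ** bm b) $ x $ y = (\<Sum>z\<in>UNIV. a ! r x z * b ! r z y)"
    by (simp add: bm_def matrix_matrix_mult_def)
  also have "\<dots> = (\<Sum>z\<in>UNIV. \<Sum>i<5. \<Sum>j<5. if r x z = i \<and> r z y = j then a ! i * b ! j else 0)"
  proof (rule sum.cong[OF refl])
    fix z
    have "(\<Sum>i<5. \<Sum>j<5. if r x z = i \<and> r z y = j then a ! i * b ! j else 0) =
        (\<Sum>i<5. if r x z = i then \<Sum>j<5. if r z y = j then a ! i * b ! j else 0 else 0)"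
      by (intro sum.cong) auto
    also have "\<dots> = a ! r x z * b ! r z y"
      using r_le by simp
    finally show "a ! r x z * b ! r z y = (\<Sum>i<5. \<Sum>j<5. if r x z = i \<and> r z y = j then a ! i * b ! j else 0)" ..
  qed
  also have "\<dots> = (\<Sum>i<5. \<Sum>j<5. \<Sum>z\<in>UNIV. if r x z = i \<and> r z y = j then a ! i * b ! j else 0)"
    by (subst sum.swap) (intro sum.cong refl sum.swap)
  also have "\<dots> = (\<Sum>i<5. \<Sum>j<5. a ! i * b ! j * of_nat (card {z. r x z = i \<and> r z y = j}))"
    by (intro sum.cong refl) (simp add: sum.If_cases mult.commute)
  also have "\<dots> = (\<Sum>i<5. \<Sum>j<5. a ! i * b ! j * of_nat (intersection_matrices ! r x y ! i ! j))"
    by (intro sum.cong refl) (simp add: r_card)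
  finally show ?thesis .
qed

definition bmul :: "rat list \<Rightarrow> rat list \<Rightarrow> rat list" where
  "bmul a b = map (\<lambda>h. \<Sum>i<5. \<Sum>j<5. a ! i * b ! j * of_nat (intersection_matrices ! h ! i ! j)) [0,1,2,3,4]"

text \<open>This turns identities between matrices indexed by vertices into arithmetic with five
  coefficients.\<close>

lemma bm_mult: "bm a ** bm b = bm (bmul a b)"
proof -
  have "(bm a ** bm b) $ x $ y = bm (bmul a b) $ x $ y" for x y
  proof -
    have "r x y \<in> {0, 1, 2, 3, 4}" using r_le[of x y] by auto
    then show ?thesis unfolding bm_mult_entry by (auto simp: bm_def bmul_def)
  qed
  then show ?thesis by (simp add: vec_eq_iff)
qed

lemma bmul_simp:
  "bmul [a0, a1, a2, a3, a4] [b0, b1, b2, b3, b4] =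
   [a0 * b0 + 8 * a1 * b1 + 8 * a2 * b2 + 4 * a3 * b3 + 24 * a4 * b4,
    a0 * b1 + a1 * b0 + a1 * b2 + 6 * a1 * b4 + a2 * b1 + 3 * a2 * b2 + a2 * b3 + 3 * a2 * b4
      + a3 * b2 + 3 * a3 * b4 + 6 * a4 * b1 + 3 * a4 * b2 + 3 * a4 * b3 + 12 * a4 * b4,
    a0 * b2 + a1 * b1 + 3 * a1 * b2 + a1 * b3 + 3 * a1 * b4 + a2 * b0 + 3 * a2 * b1 + a2 * b2 + 3 * a2 * b4
      + a3 * b1 + 3 * a3 * b4 + 3 * a4 * b1 + 3 * a4 * b2 + 3 * a4 * b3 + 15 * a4 * b4,
    a0 * b3 + 2 * a1 * b2 + 6 * a1 * b4 + 2 * a2 * b1 + 6 * a2 * b4 + a3 * b0 + 3 * a3 * b3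
      + 6 * a4 * b1 + 6 * a4 * b2 + 12 * a4 * b4,
    a0 * b4 + 2 * a1 * b1 + a1 * b2 + a1 * b3 + 4 * a1 * b4 + a2 * b1 + a2 * b2 + a2 * b3 + 5 * a2 * b4
      + a3 * b1 + a3 * b2 + 2 * a3 * b4 + a4 * b0 + 4 * a4 * b1 + 5 * a4 * b2 + 2 * a4 * b3 + 12 * a4 * b4]"
  by (simp add: bmul_def intersection_matrices_def lessThan_nat_numeral lessThan_Suc numeral_eq_Suc algebra_simps)

end

text \<open>A positive product allows zero or two negative factors, and the second assumption
  excludes zero.\<close>

lemma sgn_sum_3:
  fixes w :: "3 \<Rightarrow> rat"
  assumes "0 < (\<Prod>i\<in>UNIV. w i)" "\<not> (\<forall>i. 0 < w i)"
  shows "(\<Sum>l\<in>UNIV. sgn (w l)) = -1"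
proof -
  have pos: "0 < w 1 * (w 2 * w 3)" using assms(1) unfolding UNIV_3 by simp
  have "\<not> (0 < w 1 \<and> 0 < w 2 \<and> 0 < w 3)" using assms(2) by (simp add: forall_3)
  moreover have "(\<Sum>l\<in>UNIV. sgn (w l)) = sgn (w 1) + sgn (w 2) + sgn (w 3)" by (rule sum_3)
  ultimately show ?thesis using pos
    unfolding zero_less_mult_iff mult_less_0_iff by (elim disjE conjE) simp_all
qed

context scheme
begin

text \<open>
  \<open>Z\<close> is the orthogonal projection onto the space \<open>V\<close> of vectors with vanishing block sums, and \<open>U'\<close> is the
  inverse of \<open>U\<close> on \<open>V\<close>.
\<close>

definition "A = bm [0, 1, 0, 0, 0]"
definition "Z = bm [4/5, 0, 0, -1/5, 0]"
definition "U = bm [1, 0, -3, 0, 0]"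
definition "U' = bm [-35, 18, 3, 0, 0]"

lemma transpose_bm [simp]: "transpose (bm a) = bm a"
  by (simp add: bm_def transpose_def r_sym vec_eq_iff)

lemma Z_idem: "Z ** Z = Z"
  and Z_A: "Z ** A = A ** Z"
  and Z_U: "Z ** U = U ** Z"
  and Z_U': "Z ** U' = U' ** Z"
  and U_A: "U ** A = A ** U"
  and U_U': "U ** (U' ** Z) = Z"
  and ZU_eq: "Z ** U = bm [4/5, 3/5, -12/5, -1/5, 3/5]"
  by (simp_all add: A_def Z_def U_def U'_def bm_mult bmul_simp)

lemma bm_mult_vec_lincomb:
  assumes "a ! 0 = x * b ! 0 + y * c ! 0 + z * d ! 0" "a ! 1 = x * b ! 1 + y * c ! 1 + z * d ! 1"
    "a ! 2 = x * b ! 2 + y * c ! 2 + z * d ! 2" "a ! 3 = x * b ! 3 + y * c ! 3 + z * d ! 3"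
    "a ! 4 = x * b ! 4 + y * c ! 4 + z * d ! 4"
  shows "bm a *v v = x *s (bm b *v v) + y *s (bm c *v v) + z *s (bm d *v v)"
proof -
  have "a ! r i j = x * b ! r i j + y * c ! r i j + z * d ! r i j" for i j
  proof -
    have "r i j \<in> {0, 1, 2, 3, 4}" using r_le[of i j] by auto
    then show ?thesis using assms by auto
  qed
  then show ?thesis
    by (simp add: bm_def matrix_vector_mult_def vec_eq_iff algebra_simps sum.distrib sum_distrib_left)
qed

text \<open>On \<open>V\<close> both \<open>A_0 + A_3\<close> and the all-one matrix vanish, so
  \<open>A_3 = - I\<close> and \<open>A_4 = - A - A_2\<close> there. What remains is a
  three-dimensional algebra generated by \<open>A\<close>.\<close>

lemma A_cubed: "A *v (A *v (A *v (Z *v v))) = 12 *s (A *v (Z *v v)) - 14 *s (Z *v v)"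
proof -
  have "bm (bmul [0, 1, 0, 0, 0] (bmul [0, 1, 0, 0, 0] (bmul [0, 1, 0, 0, 0] [4/5, 0, 0, -1/5, 0]))) *v v =
      12 *s (bm (bmul [0, 1, 0, 0, 0] [4/5, 0, 0, -1/5, 0]) *v v) + (-14) *s (bm [4/5, 0, 0, -1/5, 0] *v v)
      + 0 *s (bm [4/5, 0, 0, -1/5, 0] *v v)"
    by (rule bm_mult_vec_lincomb) (simp_all add: bmul_simp)
  then show ?thesis
    by (simp add: A_def Z_def matrix_vector_mul_assoc bm_mult)
qed

text \<open>From \<open>A\<^sup>2 = 8 I + A_2 + 2 A_4\<close> it follows that
  \<open>A_2 = 8 I - 2 A - A\<^sup>2\<close> on \<open>V\<close>; substitute this into
  \<open>I - 3 A_2\<close>.\<close>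

lemma U_eq: "U *v (Z *v v) = 3 *s (A *v (A *v (Z *v v))) + 6 *s (A *v (Z *v v)) - 23 *s (Z *v v)"
proof -
  have "bm (bmul [1, 0, -3, 0, 0] [4/5, 0, 0, -1/5, 0]) *v v =
      3 *s (bm (bmul [0, 1, 0, 0, 0] (bmul [0, 1, 0, 0, 0] [4/5, 0, 0, -1/5, 0])) *v v)
      + 6 *s (bm (bmul [0, 1, 0, 0, 0] [4/5, 0, 0, -1/5, 0]) *v v) + (-23) *s (bm [4/5, 0, 0, -1/5, 0] *v v)"
    by (rule bm_mult_vec_lincomb) (simp_all add: bmul_simp)
  then show ?thesis
    by (simp add: A_def Z_def U_def matrix_vector_mul_assoc bm_mult)
qed

text \<open>Applying \<open>A\<close> twice gives, in every coordinate, a homogeneous 3 by 3 system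
  for \<open>e\<close>, \<open>u1\<close>, \<open>u2\<close> with determinant \<open>N\<close>, the
  norm of \<open>a + b \<theta> + c \<theta>\<^sup>2\<close>. So \<open>N\<close> annihilates
  \<open>e\<close>, and after clearing denominators the descent applies.\<close>

lemma A_independent:
  fixes a b c :: rat
  assumes e: "Z *v e = e" "e \<noteq> 0" and eq: "a *s e + b *s (A *v e) + c *s (A *v (A *v e)) = 0"
  shows "a = 0 \<and> b = 0 \<and> c = 0"
proof -
  define u1 u2 where "u1 = A *v e" and "u2 = A *v (A *v e)"
  have A: "A *v e = u1" "A *v u1 = u2" "A *v u2 = 12 *s u1 - 14 *s e"
    using A_cubed[of e] by (simp_all add: u1_def u2_def e)
  have eq0: "a *s e + b *s u1 + c *s u2 = 0"
    using eq by (simp add: u1_def u2_def)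
  have "A *v (a *s e + b *s u1 + c *s u2) = 0" by (simp add: eq0)
  then have eq1: "a *s u1 + b *s u2 + c *s (12 *s u1 - 14 *s e) = 0"
    by (simp add: vec.add vec.scale A)
  then have "A *v (a *s u1 + b *s u2 + c *s (12 *s u1 - 14 *s e)) = 0" by simp
  then have eq2: "a *s u2 + b *s (12 *s u1 - 14 *s e) + c *s (12 *s u2 - 14 *s u1) = 0"
    by (simp add: vec.add vec.diff vec.scale A)
  define N where "N = a ^ 3 - 14 * b ^ 3 + 196 * c ^ 3 + 24 * a\<^sup>2 * c + 144 * a * c\<^sup>2 - 12 * a * b\<^sup>2
    + 42 * a * b * c + 168 * b * c\<^sup>2"
  have "N * e $ i = 0" for i
  proof -
    have "a * e $ i + b * u1 $ i + c * u2 $ i = 0"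
      "a * u1 $ i + b * u2 $ i + c * (12 * u1 $ i - 14 * e $ i) = 0"
      "a * u2 $ i + b * (12 * u1 $ i - 14 * e $ i) + c * (12 * u2 $ i - 14 * u1 $ i) = 0"
      using arg_cong[OF eq0, of "\<lambda>v. v $ i"] arg_cong[OF eq1, of "\<lambda>v. v $ i"] arg_cong[OF eq2, of "\<lambda>v. v $ i"]
      by (simp_all only: vector_add_component vector_minus_component vector_smult_component zero_index)
    then show ?thesis unfolding N_def by algebra
  qed
  then have N0: "N = 0" using e(2) by (auto simp: vec_eq_iff)
  obtain a1 a2 where a: "a = of_int a1 / of_int a2" "a2 > 0"
    by (cases a) (auto simp: Fract_of_int_quotient)
  obtain b1 b2 where b: "b = of_int b1 / of_int b2" "b2 > 0"
    by (cases b) (auto simp: Fract_of_int_quotient)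
  obtain c1 c2 where c: "c = of_int c1 / of_int c2" "c2 > 0"
    by (cases c) (auto simp: Fract_of_int_quotient)
  define D where "D = a2 * b2 * c2"
  define a' b' c' where "a' = a1 * b2 * c2" and "b' = b1 * a2 * c2" and "c' = c1 * a2 * b2"
  have abc: "of_int a' = of_int D * a" "of_int b' = of_int D * b" "of_int c' = of_int D * c" and D: "D \<noteq> 0"
    using a b c by (simp_all add: D_def a'_def b'_def c'_def)
  have "of_int (a' ^ 3 - 14 * b' ^ 3 + 196 * c' ^ 3 + 24 * a'\<^sup>2 * c' + 144 * a' * c'\<^sup>2 - 12 * a' * b'\<^sup>2
    + 42 * a' * b' * c' + 168 * b' * c'\<^sup>2) = of_int D ^ 3 * N"
    by (simp add: abc N_def algebra_simps power2_eq_square power3_eq_cube)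
  then have "a' ^ 3 - 14 * b' ^ 3 + 196 * c' ^ 3 + 24 * a'\<^sup>2 * c' + 144 * a' * c'\<^sup>2 - 12 * a' * b'\<^sup>2
    + 42 * a' * b' * c' + 168 * b' * c'\<^sup>2 = 0"
    using N0 by (simp only: mult_zero_right of_int_eq_0_iff)
  from norm_form_descent[OF this] show ?thesis using abc D by simp
qed

text \<open>A nonzero vector in the image of \<open>R\<close> spans a line over the cubic field, and
  \<open>Q\<close> is the orthogonal projection onto it. It commutes with \<open>A\<close>, so
  \<open>R - Q\<close> can be split again. The signature is read off rational data: the norm 1 of
  \<open>U\<close> and the trace -105 of its inverse leave exactly one positive weight.\<close>

lemma cubic_piece:
  assumes R_sym: "transpose R = R" and R_idem: "R ** R = R" and RA: "R ** A = A ** R"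
    and ZR: "Z ** R = R" and R: "R \<noteq> 0"
  obtains Q g w where "transpose Q = Q" "Q ** Q = Q" "Q ** A = A ** Q" "R ** Q = Q" "trace Q = 3"
    "\<And>l::3. Q *v g l = g l"
    "\<And>l k. dot (g l) (U *v g k) = (if l = k then w l else 0)"
    "\<And>l. w l \<noteq> (0::rat)" "(\<Sum>l\<in>UNIV. sgn (w l)) = -1"
    "\<And>v. Q *v v = (\<Sum>l\<in>UNIV. (dot (U *v g l) v / w l) *s g l)"
proof -
  obtain x where x: "R *v axis x 1 \<noteq> 0"
    using R by (metis matrix_vector_mult_axis vec_eq_iff zero_index)
  define e where "e = R *v axis x 1"
  have e: "e \<noteq> 0" "R *v e = e" "Z *v e = e"
    using x by (simp_all add: e_def matrix_vector_mul_assoc R_idem ZR)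
  define f :: "3 \<Rightarrow> rat ^ 'n" where "f j = (if j = 1 then e else if j = 2 then A *v e else A *v (A *v e))" for j
  have f: "f 1 = e" "f 2 = A *v e" "f 3 = A *v (A *v e)" by (simp_all add: f_def)
  define F where "F = (\<chi> i j. f j $ i)"
  have F_vec: "F *v v = (\<Sum>j\<in>UNIV. v $ j *s f j)" for v
    by (simp add: F_def matrix_vector_mult_def vec_eq_iff mult.commute)
  have mat_F: "B ** F = F ** M" if "\<And>j. B *v f j = (\<Sum>k\<in>UNIV. M $ k $ j *s f k)" for B M
  proof -
    have "(B ** F) $ i $ j = (B *v f j) $ i" for i j
      by (simp add: F_def matrix_matrix_mult_def matrix_vector_mult_def)
    moreover have "(F ** M) $ i $ j = (\<Sum>k\<in>UNIV. M $ k $ j *s f k) $ i" for i j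
      by (simp add: F_def matrix_matrix_mult_def mult.commute)
    ultimately show ?thesis using that by (simp add: vec_eq_iff)
  qed
  \<comment> \<open>\<open>T\<close>, \<open>C\<close> and \<open>C'\<close> are the matrices of \<open>A\<close>, \<open>U\<close> and \<open>U'\<close> in the basis \<open>e, A e, A\<^sup>2 e\<close>.\<close>
  define T :: "rat ^ 3 ^ 3" where "T = vector [vector [0, 0, -14], vector [1, 0, 12], vector [0, 1, 0]]"
  define C :: "rat ^ 3 ^ 3" where "C = vector [vector [-23, -42, -84], vector [6, 13, 30], vector [3, 6, 13]]"
  define C' :: "rat ^ 3 ^ 3" where "C' = vector [vector [-11, 42, -168], vector [12, -47, 186], vector [-3, 12, -47]]"
  have CC': "C' ** C = mat 1" "C ** C' = mat 1"
    by (simp_all add: C_def C'_def vec_eq_iff forall_3 sum_3 matrix_matrix_mult_def mat_def)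
  have detC: "det C = 1" by (simp add: C_def det_3)
  have trC': "trace C' = - 105" by (simp add: C'_def trace_def sum_3)
  have A3: "A *v (A *v (A *v e)) = 12 *s (A *v e) - 14 *s e" using A_cubed[of e] e by simp
  have AF: "A ** F = F ** T"
  proof (rule mat_F)
    fix j :: 3 show "A *v f j = (\<Sum>k\<in>UNIV. T $ k $ j *s f k)"
      using exhaust_3[of j] by (auto simp: T_def sum_3 f A3)
  qed
  have Ue: "U *v e = 3 *s (A *v (A *v e)) + 6 *s (A *v e) - 23 *s e" using U_eq[of e] e by simp
  have UAe: "U *v (A *v v) = A *v (U *v v)" for v by (simp add: matrix_vector_mul_assoc U_A)
  have UF: "U ** F = F ** C"
  proof (rule mat_F)
    fix j :: 3 show "U *v f j = (\<Sum>k\<in>UNIV. C $ k $ j *s f k)"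
      using exhaust_3[of j]
      by (auto simp: C_def sum_3 f UAe Ue A3 vec.add vec.diff vec.scale) (simp_all add: vec_eq_iff)
  qed
  have RF: "R ** F = F"
  proof -
    have RAv: "R *v (A *v v) = A *v (R *v v)" for v by (simp add: matrix_vector_mul_assoc RA)
    have "R ** F = F ** mat 1"
    proof (rule mat_F)
      fix j :: 3 show "R *v f j = (\<Sum>k\<in>UNIV. mat 1 $ k $ j *s f k)"
        using exhaust_3[of j] by (auto simp: mat_def sum_3 f RAv e)
    qed
    then show ?thesis by simp
  qed
  have F0: "v = 0" if "F *v v = 0" for v
  proof -
    have "v $ 1 *s e + v $ 2 *s (A *v e) + v $ 3 *s (A *v (A *v e)) = 0"
      using that by (simp add: F_vec sum_3 f)
    from A_independent[OF e(3,1) this] show ?thesis by (simp add: vec_eq_iff forall_3)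
  qed
  define G where "G = transpose F ** F"
  have G_dot: "dot v (G *v v') = dot (F *v v) (F *v v')" for v v'
    by (simp only: G_def matrix_vector_mul_assoc[symmetric] dot_matrix_vector[of _ "transpose F"] transpose_transpose)
  have G_sym: "transpose G = G" by (simp add: G_def matrix_transpose_mul)
  have G0: "v = 0" if "G *v v = 0" for v
    using G_dot[of v v] that F0[of v] by simp
  have "\<exists>H. H ** G = mat 1" unfolding matrix_left_invertible_ker using G0 by simp
  then obtain H where HG: "H ** G = mat 1" ..
  have GH: "G ** H = mat 1" using HG by (simp only: matrix_left_right_inverse)
  have H_sym: "transpose H = H"
  proof -
    have "transpose (G ** H) = mat 1" by (simp add: GH transpose_mat)
    then have HtG: "transpose H ** G = mat 1" by (simp only: matrix_transpose_mul G_sym)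
    have "transpose H = transpose H ** (G ** H)" by (simp add: GH)
    also have "\<dots> = H" by (simp only: matrix_mul_assoc HtG matrix_mul_lid)
    finally show ?thesis .
  qed
  \<comment> \<open>The orthogonal projection onto the column space of \<open>F\<close>, since
    \<open>H\<close> inverts the Gram matrix.\<close>
  define Q where "Q = F ** (H ** transpose F)"
  have 1: "transpose Q = Q" by (simp add: Q_def matrix_transpose_mul H_sym matrix_mul_assoc)
  have QF: "Q ** F = F"
    by (simp only: Q_def matrix_mul_assoc[symmetric] G_def[symmetric] HG matrix_mul_rid)
  have 2: "Q ** Q = Q"
    by (subst (2) Q_def) (simp only: matrix_mul_assoc QF, simp only: Q_def matrix_mul_assoc)
  have 4: "R ** Q = Q" by (simp only: Q_def matrix_mul_assoc RF)
  have A_sym: "transpose A = A" by (simp add: A_def)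
  \<comment> \<open>The column space of \<open>F\<close> is invariant under \<open>A\<close>, so
    \<open>Q A Q = A Q\<close>; the left side is symmetric, and transposing gives
    \<open>Q A\<close>.\<close>
  have 3: "Q ** A = A ** Q"
  proof -
    have a: "Q ** (A ** Q) = A ** Q"
    proof -
      have "Q ** (A ** Q) = Q ** (A ** F) ** (H ** transpose F)"
        by (subst (2) Q_def) (simp only: matrix_mul_assoc)
      also have "\<dots> = A ** F ** (H ** transpose F)"
        by (simp only: AF matrix_mul_assoc QF)
      finally show ?thesis by (simp only: Q_def matrix_mul_assoc)
    qed
    have "transpose (Q ** (A ** Q)) = transpose (A ** Q)" by (simp only: a)
    then have "Q ** (A ** Q) = Q ** A"
      by (simp only: matrix_transpose_mul 1 A_sym matrix_mul_assoc)
    then show ?thesis using a by simp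
  qed
  have 5: "trace Q = 3"
  proof -
    have "trace Q = trace (H ** transpose F ** F)" unfolding Q_def by (rule trace_mul_sym)
    also have "H ** transpose F ** F = mat 1" by (simp only: HG G_def[symmetric] matrix_mul_assoc[symmetric])
    finally show ?thesis by (simp add: trace_I)
  qed
  define S where "S = G ** C"
  have U_sym: "transpose U = U" by (simp add: U_def)
  have S_eq: "S = transpose F ** (U ** F)" by (simp add: S_def G_def UF matrix_mul_assoc)
  have S_sym: "transpose S = S" by (simp add: S_eq matrix_transpose_mul U_sym matrix_mul_assoc)
  have S0: "v = 0" if "S *v v = 0" for v
  proof -
    have "C *v v = 0"
    proof (rule G0)
      show "G *v (C *v v) = 0" using that by (simp add: S_def matrix_vector_mul_assoc)
    qed
    then have "C' *v (C *v v) = 0" by simp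
    then show ?thesis by (simp add: matrix_vector_mul_assoc CC')
  qed
  obtain p w where pw: "\<And>i j::3. dot (p i) (S *v p j) = (if i = j then w i else 0)" "\<And>i. w i \<noteq> 0"
    "\<And>y. y = (\<Sum>i\<in>UNIV. (dot (p i) (S *v y) / w i) *s p i)"
    using congruent_diagonal[OF S_sym] S0 by blast
  define g where "g l = F *v p l" for l
  have 6: "Q *v g l = g l" for l by (simp add: g_def matrix_vector_mul_assoc QF)
  have 7: "dot (g l) (U *v g k) = (if l = k then w l else 0)" for l k
    unfolding pw(1)[symmetric] S_eq g_def
    by (simp only: matrix_vector_mul_assoc[symmetric] dot_matrix_vector[of _ "transpose F"] transpose_transpose)
  have 8: "Q *v v = (\<Sum>l\<in>UNIV. (dot (U *v g l) v / w l) *s g l)" for v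
  proof -
    \<comment> \<open>The coordinates of \<open>Q *v v\<close> in the basis
      \<open>e, A e, A\<^sup>2 e\<close>.\<close>
    define y where "y = H *v (transpose F *v v)"
    have Gy: "G *v y = transpose F *v v" by (simp add: y_def matrix_vector_mul_assoc GH matrix_mul_assoc)
    have "dot (U *v g l) v = dot (p l) (S *v y)" for l
    proof -
      have "dot (U *v g l) v = dot (F *v (C *v p l)) v" by (simp add: g_def matrix_vector_mul_assoc UF)
      also have "\<dots> = dot (C *v p l) (G *v y)"
        by (simp only: Gy dot_matrix_vector[of _ "transpose F"] transpose_transpose)
      also have "\<dots> = dot (S *v p l) y"
        by (simp only: dot_matrix_vector[of _ G] G_sym S_def matrix_vector_mul_assoc)
      also have "\<dots> = dot (p l) (S *v y)"
        by (simp only: dot_matrix_vector[of _ S] S_sym)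
      finally show ?thesis .
    qed
    then have "(\<Sum>l\<in>UNIV. (dot (U *v g l) v / w l) *s g l) = (\<Sum>l\<in>UNIV. (dot (p l) (S *v y) / w l) *s (F *v p l))"
      by (simp add: g_def)
    also have "\<dots> = F *v (\<Sum>l\<in>UNIV. (dot (p l) (S *v y) / w l) *s p l)"
      by (simp only: vec.sum vec.scale)
    also have "\<dots> = F *v y" using pw(3)[of y] by simp
    also have "\<dots> = Q *v v" by (simp only: y_def Q_def matrix_vector_mul_assoc matrix_mul_assoc)
    finally show ?thesis ..
  qed
  have "det G > 0"
  proof -
    obtain p' w' where p': "\<And>i j::3. dot (p' i) (G *v p' j) = (if i = j then w' i else 0)" "\<And>i. w' i \<noteq> 0"
      "\<And>y. y = (\<Sum>i\<in>UNIV. (dot (p' i) (G *v y) / w' i) *s p' i)"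
      using congruent_diagonal[OF G_sym] G0 by blast
    have "w' i > 0" for i
      using p'(1)[of i i] p'(2)[of i] dot_self_nonneg[of "F *v p' i"] by (simp add: G_dot order_less_le)
    then have "0 < (\<Prod>i\<in>UNIV. w' i)" by (intro prod_pos) auto
    then show ?thesis unfolding det_congruent_diagonal[OF p'(1), symmetric] by (simp add: zero_less_mult_iff)
  qed
  \<comment> \<open>As \<open>U\<close> has norm 1, \<open>det S = det G\<close>, so the number of
    negative weights is even.\<close>
  then have "det S > 0" by (simp add: S_def det_mul detC)
  moreover have "(\<Prod>i\<in>UNIV. w i) \<noteq> 0" using pw(2) by simp
  ultimately have w_pos: "0 < (\<Prod>i\<in>UNIV. w i)"
    unfolding det_congruent_diagonal[OF pw(1), symmetric] by (simp add: zero_less_mult_iff)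
  \<comment> \<open>If \<open>S\<close> were positive definite like \<open>G\<close>, then \<open>C' = inverse S ** G\<close> would have positive trace.\<close>
  have not_pos: "\<not> (\<forall>i. w i > 0)"
  proof
    assume pos: "\<forall>i. w i > 0"
    have SC': "S ** C' = G" by (simp add: S_def CC' flip: matrix_mul_assoc)
    have C'_col: "C' *v axis k 1 = (\<Sum>l\<in>UNIV. ((G *v p l) $ k / w l) *s p l)" for k
    proof -
      have "dot (p l) (S *v (C' *v axis k 1)) = (G *v p l) $ k" for l
        by (simp only: matrix_vector_mul_assoc SC' dot_matrix_vector[of _ G] G_sym dot_axis)
      then show ?thesis using pw(3)[of "C' *v axis k 1"] by simp
    qed
    have "trace C' = (\<Sum>k\<in>UNIV. (C' *v axis k 1) $ k)"
      by (simp add: trace_def matrix_vector_mult_axis)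
    also have "\<dots> = (\<Sum>k\<in>UNIV. \<Sum>l\<in>UNIV. (G *v p l) $ k / w l * p l $ k)"
      by (simp only: C'_col) simp
    also have "\<dots> = (\<Sum>l\<in>UNIV. \<Sum>k\<in>UNIV. (G *v p l) $ k / w l * p l $ k)"
      by (rule sum.swap)
    also have "\<dots> = (\<Sum>l\<in>UNIV. dot (p l) (G *v p l) / w l)"
      by (simp add: dot_def sum_divide_distrib mult.commute)
    also have "\<dots> \<ge> 0"
      using pos by (intro sum_nonneg divide_nonneg_nonneg) (auto simp: G_dot less_imp_le)
    finally show False by (simp add: trC')
  qed
  have 9: "(\<Sum>l\<in>UNIV. sgn (w l)) = -1"
    using w_pos not_pos by (rule sgn_sum_3)
  show ?thesis
  proof (rule that)
    show "transpose Q = Q" "Q ** Q = Q" "Q ** A = A ** Q" "R ** Q = Q" "trace Q = 3"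
      by (fact 1 2 3 4 5)+
    show "Q *v g l = g l" for l by (fact 6)
    show "dot (g l) (U *v g k) = (if l = k then w l else 0)" for l k by (fact 7)
    show "w l \<noteq> 0" for l by (fact pw(2))
    show "(\<Sum>l\<in>UNIV. sgn (w l)) = -1" by (fact 9)
    show "Q *v v = (\<Sum>l\<in>UNIV. (dot (U *v g l) v / w l) *s g l)" for v by (fact 8)
  qed
qed

end

subsection \<open>Orthogonal decomposition\<close>

context scheme
begin

text \<open>On \<open>V\<close> the matrix \<open>U\<close> is a polynomial in \<open>A\<close>, and
  \<open>R\<close> commutes with \<open>A\<close> and has its image in \<open>V\<close>.\<close>

lemma R_U_commute:
  assumes "transpose R = R" "R ** A = A ** R" "Z ** R = R"
  shows "R *v (U *v v) = U *v (R *v v)"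
proof -
  have RZ: "R ** Z = R"
  proof -
    have "transpose (Z ** R) = R" using assms by simp
    then show ?thesis by (simp add: matrix_transpose_mul assms(1) Z_def)
  qed
  have RA: "R *v (A *v x) = A *v (R *v x)" for x
    by (simp add: matrix_vector_mul_assoc assms(2))
  have RZv: "R *v (Z *v x) = R *v x" and ZRv: "Z *v (R *v x) = R *v x" for x
    by (simp_all add: matrix_vector_mul_assoc RZ assms(3))
  have "R *v (U *v v) = R *v (U *v (Z *v v))"
  proof -
    have "U *v (Z *v v) = Z *v (U *v v)" by (simp add: matrix_vector_mul_assoc Z_U)
    then show ?thesis by (simp add: RZv)
  qed
  also have "\<dots> = 3 *s (A *v (A *v (R *v v))) + 6 *s (A *v (R *v v)) - 23 *s (R *v v)"
    unfolding U_eq by (simp add: vec.add vec.diff vec.scale RA RZv)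
  also have "\<dots> = U *v (R *v v)"
    using U_eq[of "R *v v"] by (simp add: ZRv)
  finally show ?thesis .
qed

text \<open>Trace zero therefore forces such a matrix to vanish, which ends the splitting after
  twelve pieces.\<close>

lemma trace_symmetric_idempotent:
  fixes R :: "'a::linordered_idom ^ 'm ^ 'm"
  assumes "transpose R = R" "R ** R = R"
  shows "trace R = (\<Sum>i\<in>UNIV. \<Sum>j\<in>UNIV. (R $ i $ j)\<^sup>2)"
proof -
  have "R $ i $ i = (\<Sum>j\<in>UNIV. (R $ i $ j)\<^sup>2)" for i
  proof -
    have sym: "R $ j $ i = R $ i $ j" for j
      using arg_cong[OF assms(1), of "\<lambda>M. M $ i $ j"] by (simp add: transpose_def)
    have "R $ i $ i = (R ** R) $ i $ i" by (simp add: assms(2))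
    also have "\<dots> = (\<Sum>j\<in>UNIV. (R $ i $ j)\<^sup>2)"
      unfolding matrix_matrix_mult_def by (simp add: sym power2_eq_square)
    finally show ?thesis .
  qed
  then show ?thesis by (simp add: trace_def)
qed

text \<open>
  \<open>R\<close> is the projection onto the part of \<open>V\<close> that has not been split off yet. Its trace decreases by three in every
  step, so that exactly twelve pieces arise.
\<close>

definition partial_decomposition ::
  "nat \<Rightarrow> rat ^ 'n ^ 'n \<Rightarrow> (nat \<Rightarrow> 3 \<Rightarrow> rat ^ 'n) \<Rightarrow> (nat \<Rightarrow> 3 \<Rightarrow> rat) \<Rightarrow> bool" where
  "partial_decomposition k R g w \<longleftrightarrow>
    transpose R = R \<and> R ** R = R \<and> R ** A = A ** R \<and> Z ** R = R \<and> trace R = 36 - 3 * of_nat k \<and>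
    (\<forall>j<k. \<forall>l. R *v g j l = 0 \<and> Z *v g j l = g j l \<and> w j l \<noteq> 0) \<and>
    (\<forall>i<k. \<forall>j<k. \<forall>l m. dot (g i l) (U *v g j m) = (if i = j \<and> l = m then w i l else 0)) \<and>
    (\<forall>j<k. (\<Sum>l\<in>UNIV. sgn (w j l)) = -1) \<and>
    (\<forall>v. Z *v v = R *v v + (\<Sum>j<k. \<Sum>l\<in>UNIV. (dot (U *v g j l) v / w j l) *s g j l))"

lemma partial_decomposition_exists:
  assumes card: "CARD('n) = 45" and "k \<le> 12"
  shows "\<exists>R g w. partial_decomposition k R g w"
  using \<open>k \<le> 12\<close>
proof (induction k)
  case 0
  have "trace Z = 36"
  proof -
    have "r x x = 0" for x by (simp add: r_0)
    then show ?thesis using card by (simp add: trace_def Z_def bm_def)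
  qed
  moreover have "Z ** Z = Z" "Z ** A = A ** Z" "transpose Z = Z"
    by (simp_all add: Z_idem Z_A) (simp add: Z_def)
  ultimately have "partial_decomposition 0 Z g w" for g w by (simp add: partial_decomposition_def)
  then show ?case by blast
next
  case (Suc k)
  then obtain R g w where dec: "partial_decomposition k R g w" by auto
  note dec = dec[unfolded partial_decomposition_def]
  have R: "transpose R = R" "R ** R = R" "R ** A = A ** R" "Z ** R = R" "trace R = 36 - 3 * of_nat k"
    using dec by simp_all
  have "\<forall>j<k. \<forall>l. R *v g j l = 0 \<and> Z *v g j l = g j l \<and> w j l \<noteq> 0"
    using dec by (elim conjE)
  then have g: "R *v g j l = 0" "Z *v g j l = g j l" "w j l \<noteq> 0" if "j < k" for j l
    using that by simp_all
  have "\<forall>i<k. \<forall>j<k. \<forall>l m. dot (g i l) (U *v g j m) = (if i = j \<and> l = m then w i l else 0)"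
    using dec by (elim conjE)
  then have g_orth: "dot (g i l) (U *v g j m) = (if i = j \<and> l = m then w i l else 0)" if "i < k" "j < k" for i j l m
    using that by simp
  have "\<forall>j<k. (\<Sum>l\<in>UNIV. sgn (w j l)) = -1"
    using dec by (elim conjE)
  then have g_sgn: "(\<Sum>l\<in>UNIV. sgn (w j l)) = -1" if "j < k" for j
    using that by simp
  have "\<forall>v. Z *v v = R *v v + (\<Sum>j<k. \<Sum>l\<in>UNIV. (dot (U *v g j l) v / w j l) *s g j l)"
    using dec by (elim conjE)
  then have Zv: "Z *v v = R *v v + (\<Sum>j<k. \<Sum>l\<in>UNIV. (dot (U *v g j l) v / w j l) *s g j l)" for v
    by (rule spec)
  \<comment> \<open>At most eleven pieces have been split off, so the trace is at least 3.\<close>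
  have "R \<noteq> 0"
    using R(5) Suc.prems by (auto simp: trace_def)
  show ?case
  proof (rule cubic_piece[OF R(1-4) \<open>R \<noteq> 0\<close>])
    fix Q h u
    assume Q: "transpose Q = Q" "Q ** Q = Q" "Q ** A = A ** Q" "R ** Q = Q" "trace Q = 3"
      and h: "\<And>l::3. Q *v h l = h l" "\<And>l m. dot (h l) (U *v h m) = (if l = m then u l else 0)"
        "\<And>l. u l \<noteq> 0" "(\<Sum>l\<in>UNIV. sgn (u l)) = -1"
      and Qv: "\<And>v. Q *v v = (\<Sum>l\<in>UNIV. (dot (U *v h l) v / u l) *s h l)"
    have QR: "Q ** R = Q"
      using arg_cong[OF Q(4), of transpose] by (simp add: matrix_transpose_mul Q(1) R(1))
    define R' where "R' = R - Q"
    define g' where "g' j = (if j = k then h else g j)" for j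
    define w' where "w' j = (if j = k then u else w j)" for j
    have Rh: "R *v h l = h l" for l
      using h(1)[of l] Q(4) by (metis matrix_vector_mul_assoc)
    have Zh: "Z *v h l = h l" for l
      using Rh[of l] R(4) by (metis matrix_vector_mul_assoc)
    have Qg: "Q *v g j l = 0" if "j < k" for j l
    proof -
      have "Q *v g j l = Q *v (R *v g j l)" by (simp add: matrix_vector_mul_assoc QR)
      then show ?thesis by (simp add: g(1)[OF that])
    qed
    have "transpose R' = R'"
      using R(1) Q(1) by (simp add: R'_def transpose_def vec_eq_iff)
    moreover have "R' ** R' = R'"
      by (simp add: R'_def matrix_mult_diff_distrib R Q QR)
    moreover have "R' ** A = A ** R'" "Z ** R' = R'"
    proof -
      have "Z ** Q = Q" by (metis Q(4) R(4) matrix_mul_assoc)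
      then show "R' ** A = A ** R'" "Z ** R' = R'"
        by (simp_all add: R'_def matrix_mult_diff_distrib R Q)
    qed
    moreover have "trace R' = 36 - 3 * of_nat (Suc k)"
      by (simp add: R'_def trace_sub R(5) Q(5))
    moreover have "R' *v g' j l = 0 \<and> Z *v g' j l = g' j l \<and> w' j l \<noteq> 0" if "j < Suc k" for j l
      using that g Rh Zh Qg h(1,3) by (auto simp: R'_def g'_def w'_def matrix_vector_mult_diff_rdistrib)
    moreover have "dot (g' i l) (U *v g' j m) = (if i = j \<and> l = m then w' i l else 0)"
      if "i < Suc k" "j < Suc k" for i j l m
    proof -
      \<comment> \<open>\<open>R\<close> commutes with \<open>U\<close>, fixes the new vectors and
        kills the old ones.\<close>
      have 1: "dot (g i l) (U *v h m) = 0" if "i < k" for i l m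
      proof -
        have "dot (g i l) (U *v h m) = dot (g i l) (R *v (U *v h m))"
          by (simp add: R_U_commute[OF R(1,3,4)] Rh)
        also have "\<dots> = dot (R *v g i l) (U *v h m)"
          by (simp only: dot_matrix_vector[of _ R] R(1))
        finally show ?thesis by (simp add: g(1)[OF that])
      qed
      have 2: "dot (h m) (U *v g i l) = 0" if "i < k" for i l m
      proof -
        have "transpose U = U" by (simp add: U_def)
        then have "dot (h m) (U *v g i l) = dot (U *v h m) (g i l)"
          by (simp only: dot_matrix_vector[of _ U])
        then show ?thesis using 1[OF that] by (simp add: dot_commute)
      qed
      show ?thesis using that g_orth[of i j l m] h(2) 1 2 by (auto simp: g'_def w'_def less_Suc_eq)
    qed
    moreover have "(\<Sum>l\<in>UNIV. sgn (w' j l)) = -1" if "j < Suc k" for j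
      using that g_sgn h(4) by (auto simp: w'_def)
    moreover have "Z *v v = R' *v v + (\<Sum>j<Suc k. \<Sum>l\<in>UNIV. (dot (U *v g' j l) v / w' j l) *s g' j l)" for v
    proof -
      have "(\<Sum>j<k. \<Sum>l\<in>UNIV. (dot (U *v g' j l) v / w' j l) *s g' j l) =
          (\<Sum>j<k. \<Sum>l\<in>UNIV. (dot (U *v g j l) v / w j l) *s g j l)"
        by (intro sum.cong) (auto simp: g'_def w'_def)
      moreover have "(\<Sum>l\<in>UNIV. (dot (U *v g' k l) v / w' k l) *s g' k l) = Q *v v"
        by (simp add: g'_def w'_def Qv)
      ultimately show ?thesis
        by (simp add: Zv[of v] R'_def matrix_vector_mult_diff_rdistrib)
    qed
    ultimately have "partial_decomposition (Suc k) R' g' w'"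
      unfolding partial_decomposition_def by (intro conjI allI impI) (blast | assumption)+
    then show ?case by blast
  qed
qed

lemma orthogonal_decomposition:
  assumes card: "CARD('n) = 45"
  obtains g :: "nat \<Rightarrow> 3 \<Rightarrow> rat ^ 'n" and w where
    "\<And>j l. j < 12 \<Longrightarrow> Z *v g j l = g j l" "\<And>j l. j < 12 \<Longrightarrow> w j l \<noteq> 0"
    "\<And>i j l m. i < 12 \<Longrightarrow> j < 12 \<Longrightarrow> dot (g i l) (U *v g j m) = (if i = j \<and> l = m then w i l else 0)"
    "\<And>j. j < 12 \<Longrightarrow> (\<Sum>l\<in>UNIV. sgn (w j l)) = -1"
    "\<And>v. Z *v v = (\<Sum>j<12. \<Sum>l\<in>UNIV. (dot (U *v g j l) v / w j l) *s g j l)"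
proof -
  obtain R g w where dec: "partial_decomposition 12 R g w"
    using partial_decomposition_exists[OF card order_refl] by blast
  note dec = dec[unfolded partial_decomposition_def]
  have R: "transpose R = R" "R ** R = R" "trace R = 0"
    using dec by simp_all
  have "(\<Sum>i\<in>UNIV. \<Sum>j\<in>UNIV. (R $ i $ j)\<^sup>2) = 0"
    using trace_symmetric_idempotent[OF R(1,2)] R(3) by simp
  then have "R = 0"
    by (simp add: sum_nonneg_eq_0_iff sum_nonneg vec_eq_iff)
  show ?thesis
  proof (rule that)
    have "\<forall>v. Z *v v = R *v v + (\<Sum>j<12. \<Sum>l\<in>UNIV. (dot (U *v g j l) v / w j l) *s g j l)"
      using dec by (elim conjE)
    then show "Z *v v = (\<Sum>j<12. \<Sum>l\<in>UNIV. (dot (U *v g j l) v / w j l) *s g j l)" for v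
      by (simp only: \<open>R = 0\<close> matrix_vector_mult_0 add_0_left)
    have "\<forall>i<12. \<forall>j<12. \<forall>l m. dot (g i l) (U *v g j m) = (if i = j \<and> l = m then w i l else 0)"
      using dec by (elim conjE)
    then show "dot (g i l) (U *v g j m) = (if i = j \<and> l = m then w i l else 0)" if "i < 12" "j < 12" for i j l m
      using that by simp
    have "\<forall>j<12. \<forall>l. R *v g j l = 0 \<and> Z *v g j l = g j l \<and> w j l \<noteq> 0"
      using dec by (elim conjE)
    then show "Z *v g j l = g j l" "w j l \<noteq> 0" if "j < 12" for j l
      using that by simp_all
    have "\<forall>j<12. (\<Sum>l\<in>UNIV. sgn (w j l)) = -1"
      using dec by (elim conjE)
    then show "(\<Sum>l\<in>UNIV. sgn (w j l)) = -1" if "j < 12" for j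
      using that by simp
  qed
qed

end

section \<open>Integral vectors and normalisation of the orthogonal basis\<close>

definition integral_vec :: "rat ^ 'n \<Rightarrow> bool" where
  "integral_vec x \<longleftrightarrow> (\<forall>i. x $ i \<in> \<int>)"

lemma integral_vec_add: "integral_vec x \<Longrightarrow> integral_vec y \<Longrightarrow> integral_vec (x + y)"
  and integral_vec_diff: "integral_vec x \<Longrightarrow> integral_vec y \<Longrightarrow> integral_vec (x - y)"
  and integral_vec_scale: "c \<in> \<int> \<Longrightarrow> integral_vec x \<Longrightarrow> integral_vec (c *s x)"
  and integral_vec_axis: "integral_vec (axis i 1)"
  by (auto simp: integral_vec_def axis_def)

lemma dot_integral_vec: "integral_vec x \<Longrightarrow> integral_vec y \<Longrightarrow> dot x y \<in> \<int>"
  by (auto simp: integral_vec_def dot_def intro!: Ints_sum Ints_mult)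

lemma integral_vec_cases:
  assumes "integral_vec x"
  obtains \<xi> where "x = (\<chi> i. of_int (\<xi> i))"
proof
  show "x = (\<chi> i. of_int \<lfloor>x $ i\<rfloor>)"
    using assms by (auto simp: integral_vec_def vec_eq_iff elim!: Ints_cases)
qed

text \<open>Weights of the form \<open>1 / (2 a)\<close> are those for which the one-dimensional Gauss sums have a known argument.\<close>

lemma rescale_weight:
  fixes w :: rat and S :: "rat set"
  assumes "w \<noteq> 0" "finite S"
  shows "\<exists>c a::int. c > 0 \<and> a \<noteq> 0 \<and> w / (of_int c)\<^sup>2 = 1 / (2 * of_int a) \<and> of_int (sgn a) = sgn w \<and>
    (\<forall>x\<in>S. of_int c * x \<in> \<int>)"
proof -
  obtain p q where w: "w = of_int p / of_int q" "q > 0"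
    by (cases w) (auto simp: Fract_of_int_quotient)
  have p: "p \<noteq> 0" using assms w by auto
  obtain D :: nat where D: "D > 0" "\<And>x. x \<in> S \<Longrightarrow> of_nat D * x \<in> \<int>"
    using common_denominator[OF assms(2)] by auto
  \<comment> \<open>For \<open>w = p / q\<close> the requirement is
    \<open>c\<^sup>2 * q = 2 * a * p\<close>. It is solved with \<open>c\<close> divisible by the
    common denominator \<open>D\<close> and \<open>a\<close> of the sign of
    \<open>p\<close>.\<close>
  define c where "c = 2 * \<bar>p\<bar> * q * int D"
  define a where "a = 2 * p * q ^ 3 * (int D)\<^sup>2"
  have c: "c > 0" "c\<^sup>2 * q = 2 * a * p" using p w(2) D(1)
    by (simp_all add: c_def a_def power2_eq_square power3_eq_cube abs_mult_self_eq ac_simps)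
  have a: "a \<noteq> 0" using p w(2) D(1) by (simp add: a_def)
  have "(of_int c)\<^sup>2 * of_int q = 2 * of_int a * (of_int p :: rat)"
    using arg_cong[OF c(2), of "of_int :: int \<Rightarrow> rat"] by simp
  then have "w / (of_int c)\<^sup>2 = 1 / (2 * of_int a)"
  proof -
    assume "(of_int c)\<^sup>2 * of_int q = 2 * of_int a * (of_int p :: rat)"
    then have "(of_int c)\<^sup>2 = 2 * of_int a * w"
      using w(2) by (simp add: w(1) eq_divide_eq)
    then show ?thesis using assms(1) a by simp
  qed
  moreover have "of_int (sgn a) = sgn w"
    using w(2) D(1) p by (simp add: a_def w(1) sgn_mult sgn_divide) (simp add: sgn_if)
  moreover have "of_int c * x \<in> \<int>" if "x \<in> S" for x
  proof -
    have "of_int c * x = of_int (2 * \<bar>p\<bar> * q) * (of_nat D * x)" by (simp add: c_def)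
    then show ?thesis using D(2)[OF that] by (simp only: Ints_mult Ints_of_int)
  qed
  ultimately show ?thesis using c(1) a by blast
qed

context scheme
begin

text \<open>The basis is shrunk until the projection \<open>Z *v x\<close> of every integral
  \<open>x\<close> has integral coordinates. Translation by \<open>Z *v x\<close> then becomes a
  shift of the summation index.\<close>

lemma scaled_decomposition:
  assumes card: "CARD('n) = 45"
  obtains v :: "nat \<times> 3 \<Rightarrow> rat ^ 'n" and a :: "nat \<times> 3 \<Rightarrow> int" where
    "\<And>i. i \<in> {..<12} \<times> UNIV \<Longrightarrow> Z *v v i = v i" "\<And>i. i \<in> {..<12} \<times> UNIV \<Longrightarrow> a i \<noteq> 0"
    "\<And>i j. i \<in> {..<12} \<times> UNIV \<Longrightarrow> j \<in> {..<12} \<times> UNIV \<Longrightarrow>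
      dot (v i) (U *v v j) = (if i = j then 1 / (2 * of_int (a i)) else 0)"
    "(\<Sum>i\<in>{..<12} \<times> UNIV. sgn (a i)) = -12"
    "\<And>x. Z *v x = (\<Sum>i\<in>{..<12} \<times> UNIV. (2 * of_int (a i) * dot (U *v v i) x) *s v i)"
    "\<And>i x. i \<in> {..<12} \<times> UNIV \<Longrightarrow> integral_vec x \<Longrightarrow> 2 * of_int (a i) * dot (U *v v i) x \<in> \<int>"
proof (rule orthogonal_decomposition[OF card])
  fix g :: "nat \<Rightarrow> 3 \<Rightarrow> rat ^ 'n" and w
  assume g: "\<And>j l. j < 12 \<Longrightarrow> Z *v g j l = g j l" "\<And>j l. j < 12 \<Longrightarrow> w j l \<noteq> 0"
    "\<And>i j l m. i < 12 \<Longrightarrow> j < 12 \<Longrightarrow> dot (g i l) (U *v g j m) = (if i = j \<and> l = m then w i l else 0)"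
    "\<And>j. j < 12 \<Longrightarrow> (\<Sum>l\<in>UNIV. sgn (w j l)) = -1"
    "\<And>v. Z *v v = (\<Sum>j<12. \<Sum>l\<in>UNIV. (dot (U *v g j l) v / w j l) *s g j l)"
  define I :: "(nat \<times> 3) set" where "I = {..<12} \<times> UNIV"
  define h where "h i = g (fst i) (snd i)" for i
  define u where "u i = w (fst i) (snd i)" for i
  have h: "Z *v h i = h i" "u i \<noteq> 0" if "i \<in> I" for i
    using that g by (auto simp: h_def u_def I_def)
  have h_orth: "dot (h i) (U *v h j) = (if i = j then u i else 0)" if "i \<in> I" "j \<in> I" for i j
    using that g(3)[of "fst i" "fst j" "snd i" "snd j"] by (auto simp: h_def u_def I_def prod_eq_iff)
  have "\<forall>i\<in>I. \<exists>c a::int. c > 0 \<and> a \<noteq> 0 \<and> u i / (of_int c)\<^sup>2 = 1 / (2 * of_int a) \<and> of_int (sgn a) = sgn (u i) \<and>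
      (\<forall>x\<in>range (\<lambda>y. (U *v h i) $ y / u i). of_int c * x \<in> \<int>)"
    using h(2) by (intro ballI rescale_weight) auto
  then obtain c a :: "nat \<times> 3 \<Rightarrow> int" where ca: "\<And>i. i \<in> I \<Longrightarrow> c i > 0" "\<And>i. i \<in> I \<Longrightarrow> a i \<noteq> 0"
      "\<And>i. i \<in> I \<Longrightarrow> u i / (of_int (c i))\<^sup>2 = 1 / (2 * of_int (a i))" "\<And>i. i \<in> I \<Longrightarrow> of_int (sgn (a i)) = sgn (u i)"
      "\<And>i y. i \<in> I \<Longrightarrow> of_int (c i) * ((U *v h i) $ y / u i) \<in> \<int>"
    unfolding bchoice_iff by auto
  define v where "v i = (1 / of_int (c i)) *s h i" for i
  have two_a: "2 * of_int (a i) * dot (U *v v i) x = of_int (c i) * dot (U *v h i) x / u i" if "i \<in> I" for i x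
  proof -
    have "2 * of_int (a i) * u i = (of_int (c i))\<^sup>2"
      using ca(1-3)[OF that] by (simp add: field_simps)
    then show ?thesis using ca(1)[OF that] h(2)[OF that]
      by (simp add: v_def vec.scale power2_eq_square field_simps)
  qed
  show ?thesis
  proof (rule that, unfold I_def[symmetric])
    show "Z *v v i = v i" if "i \<in> I" for i using h(1)[OF that] by (simp add: v_def vec.scale)
    show "a i \<noteq> 0" if "i \<in> I" for i using ca(2)[OF that] .
    show "dot (v i) (U *v v j) = (if i = j then 1 / (2 * of_int (a i)) else 0)" if "i \<in> I" "j \<in> I" for i j
      using h_orth[OF that] ca(3)[OF that(1)]
      by (cases "i = j") (simp_all add: v_def vec.scale power2_eq_square)
    have "(of_int (\<Sum>i\<in>I. sgn (a i)) :: rat) = (\<Sum>i\<in>I. sgn (u i))"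
      using ca(4) by simp
    also have "\<dots> = (\<Sum>j<12. \<Sum>l\<in>UNIV. sgn (w j l))"
      unfolding I_def u_def by (simp add: sum.cartesian_product case_prod_unfold)
    also have "\<dots> = -12" using g(4) by simp
    finally show "(\<Sum>i\<in>I. sgn (a i)) = -12"
      by (metis of_int_eq_iff of_int_minus of_int_numeral)
    show "Z *v x = (\<Sum>i\<in>I. (2 * of_int (a i) * dot (U *v v i) x) *s v i)" for x
    proof -
      have "Z *v x = (\<Sum>i\<in>I. (dot (U *v h i) x / u i) *s h i)"
        unfolding g(5) I_def u_def h_def by (simp add: sum.cartesian_product case_prod_unfold)
      also have "\<dots> = (\<Sum>i\<in>I. (2 * of_int (a i) * dot (U *v v i) x) *s v i)"
      proof (rule sum.cong[OF refl])
        fix i assume i: "i \<in> I"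
        show "(dot (U *v h i) x / u i) *s h i = (2 * of_int (a i) * dot (U *v v i) x) *s v i"
          using ca(1)[OF i] unfolding two_a[OF i] by (simp add: v_def)
      qed
      finally show ?thesis .
    qed
    show "2 * of_int (a i) * dot (U *v v i) x \<in> \<int>" if "i \<in> I" "integral_vec x" for i x
    proof -
      have "of_int (c i) * dot (U *v h i) x / u i = (\<Sum>y\<in>UNIV. of_int (c i) * ((U *v h i) $ y / u i) * x $ y)"
        by (simp add: dot_def sum_distrib_left sum_divide_distrib mult.assoc)
      also have "\<dots> \<in> \<int>"
      proof (rule Ints_sum)
        fix y
        have "x $ y \<in> \<int>" using that(2) by (simp add: integral_vec_def)
        with ca(5)[OF that(1), of y] show "of_int (c i) * ((U *v h i) $ y / u i) * x $ y \<in> \<int>"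
          by (rule Ints_mult)
      qed
      finally show ?thesis by (simp add: two_a[OF that(1)])
    qed
  qed
qed

end

subsection \<open>Evaluation of the Gauss sum of the form\<close>

context scheme
begin

definition same_block :: "'n \<Rightarrow> 'n \<Rightarrow> bool" where
  "same_block x y \<longleftrightarrow> r x y \<in> {0, 3}"

definition block :: "'n \<Rightarrow> 'n set" where
  "block x = {y. same_block x y}"

lemma same_block_refl: "same_block x x"
  and same_block_sym: "same_block x y \<Longrightarrow> same_block y x"
  by (auto simp: same_block_def r_0 r_sym[of y x])

text \<open>Two steps in \<open>R_3\<close> never lead to \<open>R_1\<close>, \<open>R_2\<close> or
  \<open>R_4\<close>, because the intersection numbers with \<open>i = j = 3\<close> vanish
  there.\<close>

lemma same_block_trans:
  assumes "same_block x y" "same_block y z"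
  shows "same_block x z"
proof (rule ccontr)
  assume xz: "\<not> same_block x z"
  have "r x y \<noteq> 0" "r y z \<noteq> 0"
    using xz assms by (auto simp: r_0)
  then have "y \<in> {y. r x y = 3 \<and> r y z = 3}"
    using assms by (auto simp: same_block_def)
  moreover have "card {y. r x y = 3 \<and> r y z = 3} = 0"
  proof -
    have "r x z \<in> {1, 2, 4}" using r_le[of x z] xz by (auto simp: same_block_def)
    then show ?thesis by (subst r_card) (auto simp: intersection_matrices_def)
  qed
  ultimately show False by auto
qed

lemma block_eq_iff: "block x = block y \<longleftrightarrow> same_block x y"
  unfolding block_def using same_block_refl same_block_sym same_block_trans by blast

lemma fiber_block: "{y. block y = block x} = {y. same_block x y}"
  unfolding block_eq_iff using same_block_sym by blast

lemma card_block: "card (block x) = 5"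
proof -
  have "{y. r x y = 3 \<and> r y x = 3} = {y. r x y = 3}" by (auto simp: r_sym)
  then have "card {y. r x y = 3} = 4"
    using r_card[of 3 3 x x] r_0[of x x] by (simp add: intersection_matrices_def)
  moreover have "block x = insert x {y. r x y = 3}"
    by (auto simp: block_def same_block_def r_0)
  moreover have "x \<notin> {y. r x y = 3}" using r_0[of x x] by simp
  ultimately show ?thesis by simp
qed

lemma card_blocks:
  assumes "CARD('n) = 45"
  shows "card (range block) = 9"
proof -
  have "(\<Sum>B\<in>range block. \<Sum>x\<in>{x\<in>UNIV. block x = B}. 1) = (\<Sum>x\<in>(UNIV :: 'n set). 1 :: nat)"
    using sum.group[of UNIV "range block" block "\<lambda>_. 1 :: nat"] by simp
  moreover have "(\<Sum>x\<in>{x\<in>UNIV. block x = B}. 1) = (5 :: nat)" if B: "B \<in> range block" for B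
  proof -
    obtain z where "B = block z" using B by blast
    then have "{x\<in>UNIV. block x = B} = block z"
      by (simp add: fiber_block) (simp add: block_def)
    then show ?thesis by (simp add: card_block)
  qed
  ultimately show ?thesis using assms by simp
qed

definition block_sum :: "('n \<Rightarrow> 'b::comm_monoid_add) \<Rightarrow> 'n set \<Rightarrow> 'b" where
  "block_sum f B = (\<Sum>x | block x = B. f x)"

lemma sum_block_sum: "(\<Sum>B\<in>range block. block_sum f B) = (\<Sum>x\<in>UNIV. f x)"
  unfolding block_sum_def using sum.group[of UNIV "range block" block f] by simp

lemma sum_same_block:
  fixes f :: "'n \<Rightarrow> 'b::comm_ring_1"
  shows "(\<Sum>x\<in>UNIV. \<Sum>y\<in>UNIV. if same_block x y then f x * f y else 0) = (\<Sum>B\<in>range block. (block_sum f B)\<^sup>2)"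
proof -
  have "(\<Sum>y\<in>UNIV. if same_block x y then f x * f y else 0) = f x * block_sum f (block x)" for x
    by (simp add: block_sum_def fiber_block sum_distrib_left sum.If_cases)
  then have "(\<Sum>x\<in>UNIV. \<Sum>y\<in>UNIV. if same_block x y then f x * f y else 0) =
      (\<Sum>x\<in>UNIV. f x * block_sum f (block x))" by simp
  also have "\<dots> = (\<Sum>B\<in>range block. block_sum (\<lambda>x. f x * block_sum f (block x)) B)"
    by (rule sum_block_sum[symmetric])
  also have "\<dots> = (\<Sum>B\<in>range block. (block_sum f B)\<^sup>2)"
    by (intro sum.cong refl) (simp add: block_sum_def power2_eq_square sum_distrib_right)
  finally show ?thesis .
qed

lemma Z_apply: "(Z *v y) $ x = y $ x - block_sum (($) y) (block x) / 5"
proof -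
  have "(Z *v y) $ x = (\<Sum>z\<in>UNIV. (if x = z then y $ z else 0) - (if same_block x z then y $ z else 0) / 5)"
    unfolding Z_def bm_def matrix_vector_mult_def vec_lambda_beta
  proof (rule sum.cong[OF refl])
    fix z
    have "r x z \<in> {0, 1, 2, 3, 4}" using r_le[of x z] by auto
    then show "[4/5, 0, 0, -1/5, 0] ! r x z * y $ z =
        (if x = z then y $ z else 0) - (if same_block x z then y $ z else 0) / 5"
      using r_0[of x z] by (auto simp: same_block_def)
  qed
  also have "\<dots> = y $ x - (\<Sum>z\<in>UNIV. if same_block x z then y $ z else 0) / 5"
    by (simp add: sum_subtractf sum_divide_distrib)
  also have "(\<Sum>z\<in>UNIV. if same_block x z then y $ z else 0) = block_sum (($) y) (block x)"
    by (simp add: block_sum_def fiber_block sum.If_cases)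
  finally show ?thesis .
qed

text \<open>Here \<open>5 Z U = 3 J + 5 I - 15 A_2 - 4 (A_0 + A_3)\<close>, so five times the form
  is \<open>3 s\<^sup>2 + 5 X - 15 P - 4 K\<close>. Both \<open>P\<close> and
  \<open>s\<^sup>2 + X\<close> are even, hence modulo 1 half the form is
  \<open>(3 K - s\<^sup>2) / 5\<close>, which sees only the block sums.\<close>

lemma phase:
  fixes \<xi> :: "'n \<Rightarrow> int"
  defines "x \<equiv> (\<chi> i. rat_of_int (\<xi> i))"
  shows "er (dot x (Z *v (U *v x)) / 2) =
    e5 (3 * (\<Sum>B\<in>range block. (block_sum \<xi> B)\<^sup>2) - (\<Sum>B\<in>range block. block_sum \<xi> B)\<^sup>2)"
proof -
  define s where "s = (\<Sum>i\<in>UNIV. \<xi> i)"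
  define X where "X = (\<Sum>i\<in>UNIV. (\<xi> i)\<^sup>2)"
  define P where "P = (\<Sum>i\<in>UNIV. \<Sum>j\<in>UNIV. if r i j = 2 then \<xi> i * \<xi> j else 0)"
  define K where "K = (\<Sum>B\<in>range block. (block_sum \<xi> B)\<^sup>2)"
  have K: "K = (\<Sum>i\<in>UNIV. \<Sum>j\<in>UNIV. if same_block i j then \<xi> i * \<xi> j else 0)"
    unfolding K_def sum_same_block ..
  have ss: "s\<^sup>2 = (\<Sum>i\<in>UNIV. \<Sum>j\<in>UNIV. \<xi> i * \<xi> j)"
    by (simp add: s_def power2_eq_square sum_product)
  have XX: "X = (\<Sum>i\<in>UNIV. \<Sum>j\<in>UNIV. if i = j then \<xi> i * \<xi> j else 0)"
    by (simp add: X_def power2_eq_square)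
  have "r i i = 0" for i by (simp add: r_0)
  then have "even P"
    unfolding P_def by (intro even_symmetric_sum) (auto simp: r_sym mult.commute)
  then obtain P' where P': "P = 2 * P'" by blast
  have "even (s\<^sup>2 + X)"
    unfolding ss XX sum.distrib[symmetric] by (rule even_symmetric_sum) (auto simp: mult.commute)
  then obtain T where T: "s\<^sup>2 + X = 2 * T" by blast
  have "5 * dot x (Z *v (U *v x)) =
      (\<Sum>i\<in>UNIV. \<Sum>j\<in>UNIV. of_int (3 * (\<xi> i * \<xi> j) + 5 * (if i = j then \<xi> i * \<xi> j else 0)
        - 15 * (if r i j = 2 then \<xi> i * \<xi> j else 0) - 4 * (if same_block i j then \<xi> i * \<xi> j else 0)))"
  proof -
    have "5 * dot x (Z *v (U *v x)) = (\<Sum>i\<in>UNIV. \<Sum>j\<in>UNIV. 5 * ([4/5, 3/5, -12/5, -1/5, 3/5] ! r i j) * of_int (\<xi> i * \<xi> j))"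
      unfolding matrix_vector_mul_assoc ZU_eq
      by (simp add: bm_def dot_def matrix_vector_mult_def x_def sum_distrib_left mult_ac)
    also have "\<dots> = (\<Sum>i\<in>UNIV. \<Sum>j\<in>UNIV. of_int (3 * (\<xi> i * \<xi> j) + 5 * (if i = j then \<xi> i * \<xi> j else 0)
        - 15 * (if r i j = 2 then \<xi> i * \<xi> j else 0) - 4 * (if same_block i j then \<xi> i * \<xi> j else 0)))"
    proof (intro sum.cong refl)
      fix i j
      have "r i j \<in> {0, 1, 2, 3, 4}" using r_le[of i j] by auto
      then show "5 * ([4/5, 3/5, -12/5, -1/5, 3/5] ! r i j) * of_int (\<xi> i * \<xi> j) =
          (of_int (3 * (\<xi> i * \<xi> j) + 5 * (if i = j then \<xi> i * \<xi> j else 0)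
            - 15 * (if r i j = 2 then \<xi> i * \<xi> j else 0) - 4 * (if same_block i j then \<xi> i * \<xi> j else 0)) :: rat)"
        using r_0[of i j] by (auto simp: same_block_def)
    qed
    finally show ?thesis .
  qed
  also have "\<dots> = of_int (3 * s\<^sup>2 + 5 * X - 15 * P - 4 * K)"
    unfolding ss XX P_def K sum_distrib_left sum.distrib[symmetric] sum_subtractf[symmetric] of_int_sum ..
  finally have "dot x (Z *v (U *v x)) / 2 - of_int (3 * K - s\<^sup>2) / 5 = of_int (5 * (s\<^sup>2 + X) - 15 * P - 10 * K) / 10"
    by (simp add: field_simps)
  also have "\<dots> = of_int (T - 3 * P' - K)"
    unfolding T P' by simp
  finally have "er (dot x (Z *v (U *v x)) / 2) = er (of_int (3 * K - s\<^sup>2) / 5)"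
    by (intro er_cong) simp
  then show ?thesis
    unfolding er_of_int_div_5 K_def s_def sum_block_sum .
qed

lemma integral_vec_bm:
  assumes "\<forall>c\<in>{a, b, c, d, e}. c \<in> \<int>" "integral_vec x"
  shows "integral_vec (bm [a, b, c, d, e] *v x)"
proof -
  have "[a, b, c, d, e] ! r i j \<in> \<int>" for i j
  proof -
    have "r i j \<in> {0, 1, 2, 3, 4}" using r_le[of i j] by auto
    then show ?thesis using assms(1) by auto
  qed
  then show ?thesis using assms(2)
    by (auto simp: integral_vec_def bm_def matrix_vector_mult_def intro!: Ints_sum Ints_mult)
qed

lemma integral_vec_U: "integral_vec x \<Longrightarrow> integral_vec (U *v x)"
  and integral_vec_U': "integral_vec x \<Longrightarrow> integral_vec (U' *v x)"
  unfolding U_def U'_def by (auto intro!: integral_vec_bm)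

text \<open>The block sums of \<open>m\<close> vanish, so the exponent in \<open>phase\<close> is
  zero.\<close>

lemma even_form:
  assumes "integral_vec m" "Z *v m = m"
  shows "er (dot m (U *v m) / 2) = 1"
proof -
  obtain \<xi> where m: "m = (\<chi> i. of_int (\<xi> i))"
    using assms(1) by (rule integral_vec_cases)
  have 0: "block_sum \<xi> B = 0" if B: "B \<in> range block" for B
  proof -
    obtain x where x: "B = block x" using B by blast
    have "block_sum (($) m) (block x) = 0" using Z_apply[of m x] assms(2) by simp
    then have "(of_int (block_sum \<xi> B) :: rat) = 0" by (simp add: x block_sum_def m)
    then show ?thesis by simp
  qed
  have "er (dot m (Z *v (U *v m)) / 2) = 1"
    using phase[of \<xi>] by (simp add: 0 flip: m)
  moreover have "Z *v (U *v m) = U *v m"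
    by (metis assms(2) Z_U matrix_vector_mul_assoc)
  ultimately show ?thesis by simp
qed

lemma Z_block_constant:
  assumes "\<And>x y. same_block x y \<Longrightarrow> u $ x = u $ y"
  shows "Z *v u = 0"
proof -
  have "block_sum (($) u) (block x) = 5 * u $ x" for x
  proof -
    have "block_sum (($) u) (block x) = (\<Sum>y\<in>block x. u $ x)"
      unfolding block_sum_def fiber_block unfolding block_def
      by (rule sum.cong) (auto intro: assms[symmetric])
    then show ?thesis by (simp add: card_block)
  qed
  then show ?thesis by (simp add: vec_eq_iff Z_apply)
qed

lemma U_sym: "transpose U = U" and Z_sym: "transpose Z = Z"
  by (simp_all add: U_def Z_def)

lemma no_scheme:
  assumes card: "CARD('n) = 45"
  shows False
proof (rule scaled_decomposition[OF card])
  fix v :: "nat \<times> 3 \<Rightarrow> rat ^ 'n" and a :: "nat \<times> 3 \<Rightarrow> int"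
  define I :: "(nat \<times> 3) set" where "I = {..<12} \<times> UNIV"
  assume "\<And>i. i \<in> {..<12} \<times> UNIV \<Longrightarrow> Z *v v i = v i" "\<And>i. i \<in> {..<12} \<times> UNIV \<Longrightarrow> a i \<noteq> 0"
    "\<And>i j. i \<in> {..<12} \<times> UNIV \<Longrightarrow> j \<in> {..<12} \<times> UNIV \<Longrightarrow>
      dot (v i) (U *v v j) = (if i = j then 1 / (2 * of_int (a i)) else 0)"
    "(\<Sum>i\<in>{..<12} \<times> UNIV. sgn (a i)) = -12"
    "\<And>x. Z *v x = (\<Sum>i\<in>{..<12} \<times> UNIV. (2 * of_int (a i) * dot (U *v v i) x) *s v i)"
    "\<And>i x. i \<in> {..<12} \<times> UNIV \<Longrightarrow> integral_vec x \<Longrightarrow> 2 * of_int (a i) * dot (U *v v i) x \<in> \<int>"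
  note va = this[folded I_def]
  have fin: "finite I" by (simp add: I_def)
  define y where "y t = (\<Sum>i\<in>I. of_int (t i) *s v i)" for t :: "nat \<times> 3 \<Rightarrow> int"
  define q where "q x = dot x (U *v x)" for x
  define F where "F t = er (q (y t) / 2)" for t
  have Zy: "Z *v y t = y t" for t
    by (simp add: y_def vec.sum vec.scale va(1))
  have y_add: "y (\<lambda>i. t i + s i) = y t + y s" for t s
    by (simp add: y_def vec.scale_left_distrib sum.distrib)
  have ZU: "Z *v (U *v x) = U *v (Z *v x)" for x
    by (simp add: matrix_vector_mul_assoc Z_U)
  have dotZ: "dot (Z *v x) z = dot x (Z *v z)" for x z
    by (simp add: dot_matrix_vector[of x] Z_sym)
  have dotU: "dot (U *v x) z = dot x (U *v z)" for x z
    by (simp add: dot_matrix_vector[of x] U_sym)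
  have q_add: "q (x + z) = q x + 2 * dot x (U *v z) + q z" for x z
    using dotU[of z x] by (simp add: q_def vec.add dot_commute)
  have qy: "q (y t) / 2 = (\<Sum>i\<in>I. of_int ((t i)\<^sup>2) / (4 * of_int (a i)))" for t
  proof -
    have "q (y t) = (\<Sum>i\<in>I. \<Sum>j\<in>I. of_int (t i) * (of_int (t j) * dot (v j) (U *v v i)))"
      by (simp add: q_def y_def dot_sum_left dot_sum_right vec.sum vec.scale sum_distrib_left)
    also have "\<dots> = (\<Sum>i\<in>I. \<Sum>j\<in>I. if i = j then of_int ((t i)\<^sup>2) / (2 * of_int (a i)) else 0)"
      by (intro sum.cong refl) (auto simp: va(3) power2_eq_square)
    also have "\<dots> = (\<Sum>i\<in>I. of_int ((t i)\<^sup>2) / (2 * of_int (a i)))"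
      using fin by simp
    finally show ?thesis by (simp add: sum_divide_distrib)
  qed
  \<comment> \<open>A common period for all coordinates: shifting \<open>t i\<close> by
    \<open>2 * a i\<close> changes its term in \<open>qy\<close> by an integer.\<close>
  define n where "n = (\<Prod>i\<in>I. 2 * \<bar>a i\<bar>)"
  have n_pos: "n > 0" unfolding n_def using va(2) by (intro prod_pos) auto
  have n_dvd: "2 * \<bar>a i\<bar> dvd n" if "i \<in> I" for i
    unfolding n_def using fin that by (rule dvd_prodI)
  define box where "box = PiE I (\<lambda>_. {0..<n})"
  have fin_box: "finite box" unfolding box_def using fin by (intro finite_PiE) auto
  define \<Phi> where "\<Phi> = (\<Sum>t\<in>box. F t)"
  have F_prod: "F t = (\<Prod>i\<in>I. er (of_int ((t i)\<^sup>2) / (4 * of_int (a i))))" for t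
    by (simp only: F_def qy er_sum)
  have F_per: "F t = F t'" if "\<And>i. i \<in> I \<Longrightarrow> t i mod n = t' i mod n" for t t'
    unfolding F_prod
  proof (rule prod.cong[OF refl], rule er_cong)
    fix i assume i: "i \<in> I"
    have "2 * a i dvd t i - t' i"
      using n_dvd[OF i] that[OF i] by (metis abs_dvd_iff abs_mult abs_numeral dvd_trans mod_eq_dvd_iff)
    then obtain k where "t i - t' i = 2 * a i * k" by blast
    then have "t i = t' i + 2 * a i * k" by simp
    then have "of_int ((t i)\<^sup>2) / (4 * of_int (a i)) - of_int ((t' i)\<^sup>2) / (4 * of_int (a i)) = (of_int (t' i * k + a i * k\<^sup>2) :: rat)"
      using va(2)[OF i] by (simp add: field_simps power2_eq_square)
    then show "of_int ((t i)\<^sup>2) / (4 * of_int (a i)) - of_int ((t' i)\<^sup>2) / (4 * of_int (a i)) \<in> (\<int> :: rat set)"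
      by simp
  qed
  have shift: "(\<Sum>t\<in>box. F (\<lambda>i. t i + s i)) = \<Phi>" for s
    unfolding \<Phi>_def box_def using n_pos F_per by (rule sum_box_shift)
  \<comment> \<open>The coordinates of \<open>Z *v x\<close> in the basis \<open>v\<close>. For
    integral \<open>x\<close> they are integers, so the floor changes nothing.\<close>
  define \<sigma> where "\<sigma> x i = \<lfloor>2 * of_int (a i) * dot (U *v v i) x\<rfloor>" for x i
  have y_\<sigma>: "y (\<sigma> x) = Z *v x" if "integral_vec x" for x
    unfolding y_def va(5) using va(6)[OF _ that] by (intro sum.cong refl) (auto simp: \<sigma>_def elim!: Ints_cases)
  have F_shift: "F (\<lambda>i. t i + \<sigma> x i) = er (q (y t + Z *v x) / 2)" if "integral_vec x" for t x
    by (simp add: F_def y_add y_\<sigma>[OF that])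

  \<comment> \<open>Translation by the lattice \<open>M\<close>, on which the form is even, multiplies the terms of \<open>\<Phi>\<close> by characters. Hence only
    the indices \<open>t \<in> \<Lambda>\<close> with \<open>y t\<close> in the dual lattice of \<open>M\<close> contribute to \<open>\<Phi>\<close>.\<close>
  define M where "M = {m. integral_vec m \<and> Z *v m = m}"
  define G where "G x m t = F (\<lambda>i. t i + \<sigma> x i) * er (dot (y t) (U *v m))" for x m t
  have sum_G: "(\<Sum>t\<in>box. G x m t) = \<Phi>" if x: "integral_vec x" and m: "m \<in> M" for x m
  proof -
    have m': "integral_vec m" "Z *v m = m" using m by (auto simp: M_def)
    \<comment> \<open>In \<open>q (y t + Z *v x + m)\<close> the vector \<open>m\<close> contributes
      its pairing with \<open>y t\<close>, which is the character in \<open>G\<close>, and its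
      pairing with \<open>x\<close> and \<open>q m / 2\<close>, which have trivial phase.\<close>
    have "G x m t = F (\<lambda>i. t i + \<sigma> (x + m) i)" for t
    proof -
      have "q (y t + Z *v (x + m)) = q (y t + Z *v x) + 2 * dot (y t) (U *v m) + 2 * dot x (U *v m) + q m"
        unfolding vec.add m' add.assoc[symmetric] q_add[of _ m] by (simp add: dotZ ZU m')
      then have "q (y t + Z *v (x + m)) / 2 = q (y t + Z *v x) / 2 + dot (y t) (U *v m) + dot x (U *v m) + q m / 2"
        by (simp add: add_divide_distrib)
      moreover have "er (dot x (U *v m)) = 1"
        by (intro er_Ints dot_integral_vec integral_vec_U x m')
      moreover have "er (q m / 2) = 1"
        unfolding q_def by (rule even_form[OF m'])
      ultimately show ?thesis
        unfolding G_def F_shift[OF x] F_shift[OF integral_vec_add[OF x m'(1)]] by (simp only: er_add mult_1_right)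
    qed
    then show ?thesis by (simp add: shift)
  qed
  have "\<exists>D::nat. D > 0 \<and> (\<forall>z\<in>(\<lambda>(i, b). v i $ b) ` (I \<times> UNIV). of_nat D * z \<in> \<int>)"
    using fin by (intro common_denominator) auto
  then obtain D :: nat where D: "D > 0" "\<And>i b. i \<in> I \<Longrightarrow> of_nat D * v i $ b \<in> \<int>" by force
  \<comment> \<open>\<open>U\<close> permutes \<open>M\<close>, and \<open>M\<close> is generated by
    differences of unit vectors within a block. So \<open>y t\<close> is in the dual lattice exactly
    when its coordinates differ by integers inside each block.\<close>
  define h where "h = (\<lambda>(b, c) t. y t $ b - y t $ c)"
  define S where "S = {(b, c). same_block b c}"
  define \<Lambda> where "\<Lambda> = {t\<in>box. \<forall>p\<in>S. h p t \<in> \<int>}"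
  have \<Phi>_eq: "(\<Sum>t\<in>\<Lambda>. F (\<lambda>i. t i + \<sigma> x i)) = \<Phi>" if x: "integral_vec x" for x
  proof -
    have "(\<Sum>t\<in>{t\<in>box. \<forall>p\<in>S. h p t \<in> \<int>}. G x 0 t) = \<Phi>"
    proof (rule sum_restrict_characters[OF fin_box _ D(1)])
      show "of_nat D * h p t \<in> \<int>" for p t
      proof -
        have "of_nat D * y t $ b \<in> \<int>" for b
        proof -
          have "of_nat D * y t $ b = (\<Sum>i\<in>I. of_int (t i) * (of_nat D * v i $ b))"
            by (simp add: y_def sum_distrib_left mult_ac)
          also have "\<dots> \<in> \<int>"
            by (rule Ints_sum) (rule Ints_mult[OF Ints_of_int D(2)])
          finally show ?thesis .
        qed
        then show ?thesis by (cases p) (auto simp: h_def right_diff_distrib)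
      qed
      show "\<exists>m'\<in>M. \<forall>t\<in>box. G x m t * er (of_nat j * h p t) = G x m' t" if "m \<in> M" "p \<in> S" for m p j
      proof -
        obtain b c where p: "p = (b, c)" "same_block b c" using \<open>p \<in> S\<close> by (auto simp: S_def)
        define \<delta> :: "rat ^ 'n" where "\<delta> = axis b 1 - axis c 1"
        have \<delta>: "integral_vec \<delta>" by (simp add: \<delta>_def integral_vec_diff integral_vec_axis)
        have Z\<delta>: "Z *v \<delta> = \<delta>"
        proof -
          have "dot (Z *v \<delta>) z = dot \<delta> z" for z
            using p(2) block_eq_iff[of b c] by (simp add: dotZ) (simp add: \<delta>_def Z_apply)
          then have "dot (Z *v \<delta> - \<delta>) z = 0" for z by simp
          then have "Z *v \<delta> - \<delta> = 0" by (rule dot_eq_0_imp)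
          then show ?thesis by simp
        qed
        \<comment> \<open>Since \<open>U\<close> inverts \<open>U'\<close> on \<open>V\<close>,
          pairing with \<open>U *v m'\<close> adds \<open>j\<close> times a coordinate difference.
          Integrality of \<open>U'\<close> keeps \<open>m'\<close> in \<open>M\<close>: here
          \<open>U\<close> must be a unit.\<close>
        define m' where "m' = m + of_nat j *s (U' *v \<delta>)"
        have "Z *v (U' *v \<delta>) = U' *v \<delta>"
          using Z\<delta> by (metis Z_U' matrix_vector_mul_assoc)
        then have "m' \<in> M"
          using \<open>m \<in> M\<close> \<delta> by (auto simp: M_def m'_def vec.add vec.scale intro!: integral_vec_add integral_vec_scale integral_vec_U')
        moreover have "U *v (U' *v \<delta>) = \<delta>"
          using Z\<delta> U_U' by (metis matrix_vector_mul_assoc)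
        then have "dot (y t) (U *v m') = dot (y t) (U *v m) + of_nat j * h p t" for t
          by (simp add: m'_def vec.add vec.scale h_def p(1)) (simp add: \<delta>_def)
        ultimately show ?thesis
          by (intro bexI[of _ m']) (auto simp: G_def er_add mult.assoc)
      qed
    qed (use sum_G[OF x] in \<open>auto simp: M_def integral_vec_def\<close>)
    then show ?thesis by (simp add: \<Lambda>_def G_def)
  qed

  \<comment> \<open>The vectors \<open>X d\<close> represent the dual lattice modulo \<open>M\<close>, so summing over \<open>d\<close> gives the same value for every \<open>t\<close>.\<close>
  define rep where "rep B = (SOME b. block b = B)" for B
  have rep: "block (rep B) = B" if "B \<in> range block" for B
  proof -
    from that obtain b where "block b = B" by blast
    then show ?thesis unfolding rep_def by (rule someI)
  qed
  let ?P = "PiE (range block) (\<lambda>_. {0..<5::int})"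
  define X where "X d = (\<chi> b. if b = rep (block b) then rat_of_int (d (block b)) else 0)" for d :: "'n set \<Rightarrow> int"
  have X: "integral_vec (X d)" for d by (simp add: X_def integral_vec_def)
  have inner: "(\<Sum>d\<in>?P. F (\<lambda>i. t i + \<sigma> (X d) i)) = g5 3 ^ 10 / g5 1" if t: "t \<in> \<Lambda>" for t
  proof -
    \<comment> \<open>An integral vector with projection \<open>y t\<close>: subtracting a vector
      constant on blocks is invisible to \<open>Z\<close>, and for \<open>t \<in> \<Lambda>\<close>
      it leaves integers.\<close>
    define x where "x = (\<chi> b. y t $ b - y t $ rep (block b))"
    have same: "same_block b (rep (block b))" for b
      using rep[of "block b"] by (simp add: block_eq_iff[symmetric])
    have "h (b, rep (block b)) t \<in> \<int>" for b
      using t same by (auto simp: \<Lambda>_def S_def)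
    then have "integral_vec x" by (simp add: integral_vec_def x_def h_def)
    then obtain \<xi> where \<xi>: "x = (\<chi> b. of_int (\<xi> b))" by (rule integral_vec_cases)
    have Zx: "Z *v x = y t"
    proof -
      have "x = y t - (\<chi> b. y t $ rep (block b))" by (simp add: x_def vec_eq_iff)
      moreover have "Z *v (\<chi> b. y t $ rep (block b)) = 0"
        by (rule Z_block_constant) (auto simp: block_eq_iff[symmetric])
      ultimately show ?thesis by (simp add: vec.diff Zy)
    qed
    have "F (\<lambda>i. t i + \<sigma> (X d) i) = e5 (3 * (\<Sum>B\<in>range block. (block_sum \<xi> B + d B)\<^sup>2) -
        (\<Sum>B\<in>range block. block_sum \<xi> B + d B)\<^sup>2)" for d
    proof -
      \<comment> \<open>Placing \<open>d B\<close> at the representative of \<open>B\<close> raises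
        that block sum by \<open>d B\<close>, so as \<open>d\<close> varies all block sums modulo 5
        are met once.\<close>
      define \<eta> where "\<eta> b = \<xi> b + (if b = rep (block b) then d (block b) else 0)" for b
      have sum: "block_sum \<eta> B = block_sum \<xi> B + d B" if B: "B \<in> range block" for B
      proof -
        have "(\<Sum>b | block b = B. if b = rep (block b) then d (block b) else 0) =
            (\<Sum>b | block b = B. if b = rep B then d B else 0)"
          by (rule sum.cong) auto
        also have "\<dots> = d B" using rep[OF B] by simp
        finally show ?thesis by (simp add: block_sum_def \<eta>_def sum.distrib)
      qed
      define z :: "rat ^ 'n" where "z = (\<chi> b. of_int (\<eta> b))"
      have z: "x + X d = z" by (simp add: \<xi> X_def z_def \<eta>_def vec_eq_iff)
      have "F (\<lambda>i. t i + \<sigma> (X d) i) = er (q (Z *v z) / 2)"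
        by (simp add: F_shift[OF X] z[symmetric] vec.add Zx)
      also have "q (Z *v z) = dot z (Z *v (U *v z))"
        by (simp add: q_def dotZ ZU) (simp add: matrix_vector_mul_assoc Z_idem)
      finally show ?thesis
        using phase[of \<eta>] by (simp add: z_def sum)
    qed
    then show ?thesis
      using block_gauss_sum[of "range block" "block_sum \<xi>"] card_blocks[OF card] by simp
  qed
  have "of_nat (card ?P) * \<Phi> = (\<Sum>d\<in>?P. \<Sum>t\<in>\<Lambda>. F (\<lambda>i. t i + \<sigma> (X d) i))"
    by (simp add: \<Phi>_eq[OF X])
  also have "\<dots> = (\<Sum>t\<in>\<Lambda>. \<Sum>d\<in>?P. F (\<lambda>i. t i + \<sigma> (X d) i))"
    by (rule sum.swap)
  also have "\<dots> = of_nat (card \<Lambda>) * (g5 3 ^ 10 / g5 1)"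
    by (simp add: inner)
  finally have \<Phi>_nonneg: "of_nat (card ?P) * \<Phi> = of_nat (card \<Lambda>) * (g5 3 ^ 10 / g5 1)" .

  have "\<exists>R>0. (\<Sum>t\<in>{0..<n}. er (of_int (t\<^sup>2) / (4 * of_int (a i)))) = of_real R * cis (pi / 4 * of_int (sgn (a i)))"
    if i: "i \<in> I" for i
  proof -
    obtain k where k: "n = 2 * \<bar>a i\<bar> * k" using n_dvd[OF i] by blast
    then have "k > 0" using n_pos va(2)[OF i] by (simp add: zero_less_mult_iff)
    moreover have "sgn (of_int (a i)) = real_of_int (sgn (a i))" by (simp add: sgn_if)
    ultimately show ?thesis
      using sum_e1_square[OF va(2)[OF i], of k]
      unfolding k er_def by (simp add: of_rat_divide of_rat_mult of_rat_power)
  qed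
  then obtain \<rho> where \<rho>: "\<And>i. i \<in> I \<Longrightarrow> \<rho> i > 0" "\<And>i. i \<in> I \<Longrightarrow>
      (\<Sum>t\<in>{0..<n}. er (of_int (t\<^sup>2) / (4 * of_int (a i)))) = of_real (\<rho> i) * cis (pi / 4 * of_int (sgn (a i)))"
    by metis
  have cis_sum: "(\<Prod>i\<in>J. cis (\<theta> i)) = cis (\<Sum>i\<in>J. \<theta> i)" for J :: "(nat \<times> 3) set" and \<theta>
    by (induction J rule: infinite_finite_induct) (auto simp: cis_mult)
  have "\<Phi> = (\<Prod>i\<in>I. \<Sum>t\<in>{0..<n}. er (of_int (t\<^sup>2) / (4 * of_int (a i))))"
    unfolding \<Phi>_def box_def F_prod using fin by (intro prod_sum_PiE[symmetric]) auto
  also have "\<dots> = (\<Prod>i\<in>I. of_real (\<rho> i) * cis (pi / 4 * of_int (sgn (a i))))"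
    by (rule prod.cong[OF refl \<rho>(2)])
  also have "\<dots> = of_real (\<Prod>i\<in>I. \<rho> i) * cis (pi / 4 * of_int (\<Sum>i\<in>I. sgn (a i)))"
    by (simp add: prod.distrib cis_sum sum_distrib_left)
  also have "\<dots> = - of_real (\<Prod>i\<in>I. \<rho> i)"
  proof -
    \<comment> \<open>The signs sum to -12, and -12 * pi / 4 = -3 * pi.\<close>
    have "cis (- (3 * pi)) = -1"
      using cis_multiple_2pi[of "-2"] cis_mult[of pi "2 * pi * -2"] by simp
    then show ?thesis by (simp add: va(4) mult.commute)
  qed
  finally have \<Phi>_neg: "\<Phi> = - of_real (\<Prod>i\<in>I. \<rho> i)" .
  have pos: "(\<Prod>i\<in>I. \<rho> i) > 0" using \<rho>(1) by (intro prod_pos) auto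
  obtain g where g: "g \<ge> 0" "g5 3 ^ 10 / g5 1 = of_real g" using block_gauss_value_nonneg by blast
  have "finite ?P" by (intro finite_PiE) auto
  moreover have "?P \<noteq> {}" by (simp add: PiE_eq_empty_iff)
  ultimately have "card ?P > 0" by (simp add: card_gt_0_iff)
  have "complex_of_real (- (of_nat (card ?P) * (\<Prod>i\<in>I. \<rho> i))) = of_real (of_nat (card \<Lambda>) * g)"
    using \<Phi>_nonneg unfolding \<Phi>_neg g(2) by simp
  then have "- (of_nat (card ?P) * (\<Prod>i\<in>I. \<rho> i)) = of_nat (card \<Lambda>) * g"
    by (simp only: of_real_eq_iff)
  moreover have "of_nat (card ?P) * (\<Prod>i\<in>I. \<rho> i) > 0" using pos \<open>card ?P > 0\<close> by simp
  moreover have "of_nat (card \<Lambda>) * g \<ge> 0" using g(1) by simp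
  ultimately show False by linarith
qed

end

section \<open>Passage from the relations to a labelling over a type with 45 elements\<close>

lemma disjoint_family_on_unique:
  "disjoint_family_on R I \<Longrightarrow> i \<in> I \<Longrightarrow> j \<in> I \<Longrightarrow> z \<in> R i \<Longrightarrow> z \<in> R j \<Longrightarrow> i = j"
  by (auto simp: disjoint_family_on_def)

theorem theorem5p3:
  shows "\<not> (\<exists>(X :: 'a set) (R :: nat \<Rightarrow> ('a \<times> 'a) set).
           symmetric_association_scheme X {0..4} 0 R \<and>
           (\<forall>h\<in>{0..4}. \<forall>i\<in>{0..4}. \<forall>j\<in>{0..4}.
              is_intersection_number X R h i j (intersection_matrices ! h ! i ! j)))"
proof
  assume "\<exists>(X :: 'a set) (R :: nat \<Rightarrow> ('a \<times> 'a) set).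
           symmetric_association_scheme X {0..4} 0 R \<and>
           (\<forall>h\<in>{0..4}. \<forall>i\<in>{0..4}. \<forall>j\<in>{0..4}.
              is_intersection_number X R h i j (intersection_matrices ! h ! i ! j))"
  then obtain X :: "'a set" and R :: "nat \<Rightarrow> ('a \<times> 'a) set"
    where scheme: "symmetric_association_scheme X {0..4} 0 R"
      and "\<forall>h\<in>{0..4}. \<forall>i\<in>{0..4}. \<forall>j\<in>{0..4}. is_intersection_number X R h i j (intersection_matrices ! h ! i ! j)"
    by blast
  then have card: "card {z \<in> X. (x, z) \<in> R i \<and> (z, y) \<in> R j} = intersection_matrices ! h ! i ! j"
    if "(x, y) \<in> R h" "h < 5" "i < 5" "j < 5" for x y h i j
    using that unfolding is_intersection_number_def by fastforce
  from scheme have fin: "finite X" and R0: "R 0 = Id_on X" "R 0 \<noteq> {}"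
    and sym: "\<And>i. i < 5 \<Longrightarrow> sym (R i)" and cover: "(\<Union>i\<in>{0..4}. R i) = X \<times> X"
    and disj: "disjoint_family_on R {0..4}"
    unfolding symmetric_association_scheme_def by auto
  have ex: "\<exists>i<5. (x, y) \<in> R i" if "x \<in> X" "y \<in> X" for x y
  proof -
    have "(x, y) \<in> (\<Union>i\<in>{0..4}. R i)" using that cover by simp
    then show ?thesis by (auto simp: less_Suc_eq_le numeral_eq_Suc)
  qed
  have uniq: "i = j" if "i < 5" "j < 5" "(x, y) \<in> R i" "(x, y) \<in> R j" for i j x y
    using that by (intro disjoint_family_on_unique[OF disj]) auto
  have symD: "(y, x) \<in> R i \<longleftrightarrow> (x, y) \<in> R i" if "i < 5" for i x y
    using sym[OF that] by (auto dest: symD)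
  \<comment> \<open>Sorting all vertices by their relation to a fixed \<open>x\<close> adds up the
    valencies 1 + 8 + 8 + 4 + 24.\<close>
  have "card X = 45"
  proof -
    obtain x where x: "x \<in> X" "(x, x) \<in> R 0" using R0 by auto
    have "\<exists>i<5. (x, z) \<in> R i \<and> (z, x) \<in> R i" if "z \<in> X" for z
      using ex[OF x(1) that] symD by blast
    then have "X = (\<Union>i\<in>{..<5}. {z \<in> X. (x, z) \<in> R i \<and> (z, x) \<in> R i})"
      by auto
    then have "card X = card (\<Union>i\<in>{..<5}. {z \<in> X. (x, z) \<in> R i \<and> (z, x) \<in> R i})" by simp
    also have "\<dots> = (\<Sum>i<5. card {z \<in> X. (x, z) \<in> R i \<and> (z, x) \<in> R i})"
      using fin uniq by (intro card_UN_disjoint) auto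
    also have "\<dots> = (\<Sum>i<5. intersection_matrices ! 0 ! i ! i)"
      using card[OF x(2)] by simp
    also have "\<dots> = 45"
      by (simp add: intersection_matrices_def lessThan_nat_numeral lessThan_Suc numeral_eq_Suc)
    finally show ?thesis .
  qed
  \<comment> \<open>The numeral type \<open>45\<close> serves as the index type of the
    matrices.\<close>
  then obtain f :: "45 \<Rightarrow> 'a" where f: "bij_betw f UNIV X"
    using finite_same_card_bij[of "UNIV :: 45 set" X] fin by auto
  have fX: "f x \<in> X" for x using f by (auto simp: bij_betw_def)
  define r where "r x y = (THE i. i < 5 \<and> (f x, f y) \<in> R i)" for x y
  have r: "r x y < 5" "(f x, f y) \<in> R (r x y)" for x y
  proof -
    have "\<exists>!i. i < 5 \<and> (f x, f y) \<in> R i" using ex[OF fX fX] uniq by blast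
    from theI'[OF this] show "r x y < 5" "(f x, f y) \<in> R (r x y)" by (simp_all add: r_def)
  qed
  have r_iff: "r x y = i \<longleftrightarrow> (f x, f y) \<in> R i" if "i < 5" for x y i
    using r[of x y] uniq that by blast
  interpret scheme r
  proof
    show "r x y < 5" for x y by (rule r)
    show "r x y = 0 \<longleftrightarrow> x = y" for x y
      using f fX by (simp add: r_iff R0 Id_on_def bij_betw_def inj_eq) blast
    show "r x y = r y x" for x y
      using r[of y x] by (simp add: r_iff symD)
    show "card {z. r x z = i \<and> r z y = j} = intersection_matrices ! r x y ! i ! j" if "i < 5" "j < 5" for i j x y
    proof -
      have "bij_betw f {z. r x z = i \<and> r z y = j} {z \<in> X. (f x, z) \<in> R i \<and> (z, f y) \<in> R j}"
        using f that by (auto simp: bij_betw_def r_iff inj_on_def)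
      from bij_betw_same_card[OF this] show ?thesis by (simp only: card[OF r(2,1) that])
    qed
  qed
  show False by (rule no_scheme) simp
qed

end
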